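(* Let $\mathcal{H}$, $\mathcal{H}'$ be graded, connected Hopf algebras over $\mathbb{R}$ with bases $\mathcal{B}=\amalg_n\mathcal{B}_n$, $\mathcal{B}'=\amalg_n\mathcal{B}'_n$ respectively, each of which satisfies the descent operator chain conditions (i)–(iii). Suppose that, for all $n$, $\theta:\mathcal{B}_n\to\mathcal{B}'_n$ is such that the "preimage sum" map $\theta^*:\mathcal{B}'_n\to\mathcal{H}_n$, defined by $\theta^*(x'):=\sum_{x\in\mathcal{B},\,\theta(x)=x'}x$, extends (linearly, over all $n$) to a Hopf-morphism $\mathcal{H}'\to\mathcal{H}$. Then, for every $n\ge1$ and every probability distribution $P$ on weak-compositions of $n$, the Markov chain on $\mathcal{B}_n$ which the Doob transform constructs from the descent operator $m\circ\Delta_P$ lumps weakly via $\theta$ to the Doob transform chain on $\mathcal{B}'_n$ from the same descent operator $m\circ\Delta_P$ on $\mathcal{H}'_n$, from any starting distribution $X_0$ satisfying $\frac{X_0(x)}{\eta(x)}=\frac{X_0(y)}{\eta(y)}$ whenever $\theta(x)=\theta(y)$, where $\eta$ is the rescaling function on $\mathcal{B}_n$.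
   Context: All Markov chains are discrete-time, time-homogeneous, with finite state space; the transition matrix is $K(x,y)=P\{X_t=y\mid X_{t-1}=x\}$. In particular the bases $\mathcal{B}_n$ of the graded pieces $\mathcal{H}_n$ are finite. Descent operators. Let $\mathcal{H}=\bigoplus_{n\ge0}\mathcal{H}_n$ be a graded connected Hopf algebra with product $m$ and coproduct $\Delta$; $m$ also denotes the iterated product $\mathcal{H}^{\otimes l}\to\mathcal{H}$. A weak-composition of $n$ is a finite list $D=(d_1,\dots,d_{l(D)})$ of non-negative integers with sum $n$. $\Delta_D:\mathcal{H}_n\to\mathcal{H}_{d_1}\otimes\cdots\otimes\mathcal{H}_{d_{l(D)}}$ is the projection of the iterated coproduct $\mathcal{H}\to\mathcal{H}^{\otimes l(D)}$ to the graded subspace $\mathcal{H}_{d_1}\otimes\cdots\otimes\mathcal{H}_{d_{l(D)}}$. For a probability distribution $P$ on weak-compositions of $n$, $$m\circ\Delta_P:=\sum_D\frac{P(D)}{\binom{n}{d_1\,\dots\,d_{l(D)}}}\,m\circ\Delta_D:\mathcal{H}_n\to\mathcal{H}_n.$$ Descent operator chain conditions on a basis $\mathcal{B}=\amalg_n\mathcal{B}_n$ of $\mathcal{H}$ (with $\mathcal{B}_n$ a basis of $\mathcal{H}_n$): first, $\mathcal{B}_1=\{\bullet\}$ has exactly one element; and (i) for all $w,z\in\mathcal{B}$, the expansion of $m(w\otimes z)$ in $\mathcal{B}$ has all coefficients non-negative; (ii) for all $x\in\mathcal{B}$, the expansion of $\Delta(x)$ in $\mathcal{B}\otimes\mathcal{B}$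 has all coefficients non-negative; (iii) for all $x\in\mathcal{B}_n$ with $n>1$, $\Delta(x)\ne1\otimes x+x\otimes1$. (The requirement $|\mathcal{B}_1|=1$ is included whenever "conditions (i)–(iii)" are mentioned.) Doob transform chain. Under these conditions, define the rescaling function $\eta:\mathcal{B}_n\to\mathbb{R}$ (extended linearly to $\mathcal{H}_n$) by $\eta(x):=$ coefficient of $\bullet^{\otimes n}$ in $\Delta_{1,\dots,1}(x)$. It is known that $\eta>0$ on $\mathcal{B}_n$ and $\eta\circ(m\circ\Delta_P)=\eta$, and that, with $K(x,y)$ the coefficient of $y$ in $m\circ\Delta_P(x)$, the matrix $\check K(x,y):=K(x,y)\frac{\eta(y)}{\eta(x)}$ is a transition matrix on $\mathcal{B}_n$. The associated chain is the Doob transform chain from $m\circ\Delta_P$ on $\mathcal{B}_n$. The chain on $\mathcal{B}'_n$ is defined in the same way using $\mathcal{H}',\mathcal{B}'$ and its own rescaling function. Weak lumping. A chain $\{X_t\}$ on $\Omega$ lumps weakly via $\theta$, from the initial distribution $X_0$, to a chain on $\Omega'$ with transition matrix $K'$ if $\theta:\Omega\to\Omega'$ is a surjection such that the process $\{\theta(X_t)\}$, started at the specified $X_0$, is a Markov chain with transition matrix $K'$. *)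

theory Defs
  imports "HOL-Probability.Probability" "HOL-Library.Poly_Mapping"
begin

section \<open>Tensor powers of a real vector space\<close>

text \<open>
  The library has no tensor products. All tensor powers of \<open>V\<close> are built at once, as the tensor
  algebra \<open>T(V)\<close>, the direct sum of the powers \<open>V\<^sup>\<otimes>\<^sup>l\<close>: the vector space freely generated by the
  words over \<open>V\<close>, modulo linearity in each letter.
\<close>

instantiation poly_mapping :: (type, real_vector) real_vector
begin

lift_definition scaleR_poly_mapping :: "real \<Rightarrow> ('a \<Rightarrow>\<^sub>0 'b) \<Rightarrow> ('a \<Rightarrow>\<^sub>0 'b)"
  is "\<lambda>r f k. r *\<^sub>R f k"
  by (erule rev_finite_subset) auto

instance
  by standard (transfer; simp add: scaleR_add_right scaleR_add_left)+

end

lemma lookup_scaleR [simp]: "Poly_Mapping.lookup (r *\<^sub>R f) k = r *\<^sub>R Poly_Mapping.lookup f k"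
  by (simp add: scaleR_poly_mapping.rep_eq)

definition multilinearity_relations :: "('a::real_vector list \<Rightarrow>\<^sub>0 real) set" where
  "multilinearity_relations =
     {Poly_Mapping.single (xs @ (a + b) # ys) 1
        - Poly_Mapping.single (xs @ a # ys) 1 - Poly_Mapping.single (xs @ b # ys) 1 | xs a b ys. True}
   \<union> {Poly_Mapping.single (xs @ (r *\<^sub>R a) # ys) 1
        - r *\<^sub>R Poly_Mapping.single (xs @ a # ys) 1 | xs r a ys. True}"

definition tensor_rel :: "('a::real_vector list \<Rightarrow>\<^sub>0 real) \<Rightarrow> ('a list \<Rightarrow>\<^sub>0 real) \<Rightarrow> bool" where
  "tensor_rel u v \<longleftrightarrow> u - v \<in> span multilinearity_relations"

quotient_type (overloaded) 'a tensor = "'a::real_vector list \<Rightarrow>\<^sub>0 real" / tensor_rel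
proof (rule equivpI)
  show "reflp tensor_rel"
    by (rule reflpI) (simp add: tensor_rel_def span_zero)
  show "symp tensor_rel"
    by (rule sympI) (use span_neg in \<open>fastforce simp: tensor_rel_def\<close>)
  show "transp tensor_rel"
    by (rule transpI) (use span_add in \<open>fastforce simp: tensor_rel_def\<close>)
qed

instantiation tensor :: (real_vector) real_vector
begin

lift_definition zero_tensor :: "'a tensor" is 0 .

lift_definition plus_tensor :: "'a tensor \<Rightarrow> 'a tensor \<Rightarrow> 'a tensor" is "(+)"
  unfolding tensor_rel_def add_diff_add by (rule span_add)

lift_definition uminus_tensor :: "'a tensor \<Rightarrow> 'a tensor" is uminus
  unfolding tensor_rel_def minus_diff_minus by (rule span_neg)

lift_definition minus_tensor :: "'a tensor \<Rightarrow> 'a tensor \<Rightarrow> 'a tensor" is "(-)"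
  unfolding tensor_rel_def diff_diff_eq2 using span_diff by (fastforce simp: algebra_simps)

lift_definition scaleR_tensor :: "real \<Rightarrow> 'a tensor \<Rightarrow> 'a tensor" is "scaleR"
  unfolding tensor_rel_def scaleR_diff_right [symmetric] by (rule span_scale)

instance
  by standard
    (transfer; simp add: tensor_rel_def span_zero algebra_simps)+

end

text \<open>\<open>tens [x\<^sub>1, \<dots>, x\<^sub>l]\<close> is the pure tensor \<open>x\<^sub>1 \<otimes> \<dots> \<otimes> x\<^sub>l\<close>.\<close>

lift_definition tens :: "'a::real_vector list \<Rightarrow> 'a tensor" is "\<lambda>xs. Poly_Mapping.single xs 1" .

definition tensor_power :: "'a itself \<Rightarrow> nat \<Rightarrow> 'a::real_vector tensor set" where
  "tensor_power _ l = span {tens xs | xs. length xs = l}"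

definition multilinear :: "('a::real_vector list \<Rightarrow> 'b::real_vector) \<Rightarrow> bool" where
  "multilinear f \<longleftrightarrow> (\<forall>xs ys. linear (\<lambda>a. f (xs @ a # ys)))"

text \<open>The linear map on \<open>T(V)\<close> with prescribed values on pure tensors. It exists and is unique for
  multilinear \<open>f\<close> (lemmas \<open>tensor_lift_tens\<close>, \<open>linear_tensor_lift\<close>, \<open>tensor_lift_unique\<close>).\<close>

definition tensor_lift :: "('a::real_vector list \<Rightarrow> 'b::real_vector) \<Rightarrow> 'a tensor \<Rightarrow> 'b" where
  "tensor_lift f = (THE g. linear g \<and> (\<forall>xs. g (tens xs) = f xs))"

lemma span_tens: "span (range tens) = UNIV"
proof -
  have "t \<in> span (range tens)" for t :: "'a tensor"
  proof (induction t rule: tensor.abs_induct)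
    fix u :: "'a list \<Rightarrow>\<^sub>0 real"
    show "abs_tensor u \<in> span (range tens)"
    proof (induction u rule: update_induct)
      case const
      then show ?case by (metis span_zero zero_tensor.abs_eq)
    next
      case (update f a b)
      have "Poly_Mapping.update a b f = f + b *\<^sub>R Poly_Mapping.single a 1"
        using update(1)
        by (intro poly_mapping_eqI) (auto simp: lookup_update lookup_add lookup_single in_keys_iff when_def)
      then have "abs_tensor (Poly_Mapping.update a b f) = abs_tensor f + b *\<^sub>R tens a"
        by (simp add: plus_tensor.abs_eq scaleR_tensor.abs_eq tens.abs_eq)
      then show ?case using update by (simp add: span_add span_scale span_base)
    qed
  qed
  then show ?thesis by auto
qed

lemma linear_eq_on_tens:
  assumes "linear g" "linear h" "\<And>xs. g (tens xs) = h (tens xs)"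
  shows "g = h"
proof
  fix t show "g t = h t"
    by (rule linear_eq_on[OF assms(1,2), of t "range tens"]) (auto simp: span_tens assms(3))
qed

lemma tensor_lift_exists:
  fixes f :: "'a::real_vector list \<Rightarrow> 'b::real_vector"
  assumes "multilinear f"
  shows "\<exists>g. linear g \<and> (\<forall>xs. g (tens xs) = f xs)"
proof -
  define F where "F u = (\<Sum>xs\<in>Poly_Mapping.keys u. Poly_Mapping.lookup u xs *\<^sub>R f xs)" for u :: "'a list \<Rightarrow>\<^sub>0 real"
  have F: "F u = (\<Sum>xs\<in>A. Poly_Mapping.lookup u xs *\<^sub>R f xs)" if "finite A" "Poly_Mapping.keys u \<subseteq> A" for u A
    unfolding F_def using that by (intro sum.mono_neutral_left) (auto simp: in_keys_iff)
  have linF: "linear F"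
  proof (rule linearI)
    fix u v :: "'a list \<Rightarrow>\<^sub>0 real" and r :: real
    show "F (u + v) = F u + F v"
      using keys_add[of u v]
      by (simp add: F[of "Poly_Mapping.keys u \<union> Poly_Mapping.keys v"] lookup_add scaleR_add_left sum.distrib)
    have "Poly_Mapping.keys (r *\<^sub>R u) \<subseteq> Poly_Mapping.keys u" by (auto simp: in_keys_iff)
    then show "F (r *\<^sub>R u) = r *\<^sub>R F u"
      by (simp add: F[of "Poly_Mapping.keys u"] scaleR_sum_right)
  qed
  have Fs: "F (Poly_Mapping.single xs 1) = f xs" for xs
    by (simp add: F_def)
  have lin: "linear (\<lambda>a. f (xs @ a # ys))" for xs ys
    using assms by (simp add: multilinear_def)
  note add = linear_add[OF lin] and scale = linear_scale[OF lin]
  have ker: "F u = 0" if "u \<in> multilinearity_relations" for u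
    using that unfolding multilinearity_relations_def
    by (auto simp: linear_diff[OF linF] linear_scale[OF linF] Fs add scale)
  have ker': "F u = 0" if "u \<in> span multilinearity_relations" for u
    using that ker linear_eq_0_on_span[OF linF] by blast
  have resp: "F u = F v" if "tensor_rel u v" for u v
    using ker'[of "u - v"] that by (simp add: tensor_rel_def linear_diff[OF linF])
  define g where "g t = F (rep_tensor t)" for t
  have g: "g (abs_tensor u) = F u" for u
    unfolding g_def
    by (rule resp, rule Quotient3_rep_abs[OF Quotient3_tensor]) (simp add: tensor_rel_def span_zero)
  have "linear g"
  proof (rule linearI)
    show "g (s + t) = g s + g t" for s t
      by (induction s rule: tensor.abs_induct, induction t rule: tensor.abs_induct)
        (simp add: plus_tensor.abs_eq g linear_add[OF linF])
    show "g (r *\<^sub>R s) = r *\<^sub>R g s" for s r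
      by (induction s rule: tensor.abs_induct)
        (simp add: scaleR_tensor.abs_eq g linear_scale[OF linF])
  qed
  moreover have "g (tens xs) = f xs" for xs
    by (simp add: tens.abs_eq g Fs)
  ultimately show ?thesis by blast
qed

lemma tensor_lift_unique:
  assumes "linear g" "\<And>xs. g (tens xs) = f xs"
  shows "tensor_lift f = g"
  unfolding tensor_lift_def
  using assms by (intro the_equality) (auto intro: linear_eq_on_tens)

lemma
  assumes "multilinear f"
  shows linear_tensor_lift: "linear (tensor_lift f)"
    and tensor_lift_tens: "tensor_lift f (tens xs) = f xs"
  using tensor_lift_exists[OF assms] tensor_lift_unique by metis+

lemma multilinear_tens: "multilinear (tens :: 'a::real_vector list \<Rightarrow> _)"
proof -
  have *: "abs_tensor u = abs_tensor v" if "u - v \<in> span multilinearity_relations"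
    for u v :: "'a list \<Rightarrow>\<^sub>0 real"
    using that by (simp add: tensor.abs_eq_iff tensor_rel_def)
  have "tens (xs @ (a + b) # ys) = tens (xs @ a # ys) + tens (xs @ b # ys)"
    and "tens (xs @ (r *\<^sub>R a) # ys) = r *\<^sub>R tens (xs @ a # ys)" for xs ys and a b :: 'a and r
    unfolding tens.abs_eq plus_tensor.abs_eq scaleR_tensor.abs_eq
    by (rule *, rule span_base, force simp: multilinearity_relations_def algebra_simps)+
  then show ?thesis
    unfolding multilinear_def by (auto intro: linearI)
qed

lemma multilinear_tensor_lift:
  fixes f :: "'a::real_vector list \<Rightarrow> 'b::real_vector list \<Rightarrow> 'c::real_vector"
  assumes f: "\<And>xs. multilinear (f xs)" and f': "\<And>ys. multilinear (\<lambda>xs. f xs ys)"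
  shows "multilinear (\<lambda>xs. tensor_lift (f xs) t)"
  unfolding multilinear_def
proof (intro allI linearI)
  fix xs ys :: "'a list" and a b :: 'a and r :: real
  note lin = linear_tensor_lift[OF f]
  have lin': "linear (\<lambda>a. f (xs @ a # ys) zs)" for zs
    using f'[of zs] by (simp add: multilinear_def)
  have "tensor_lift (f (xs @ (a + b) # ys)) =
      (\<lambda>t. tensor_lift (f (xs @ a # ys)) t + tensor_lift (f (xs @ b # ys)) t)"
    by (rule tensor_lift_unique)
      (auto intro: linear_compose_add lin simp: tensor_lift_tens[OF f] linear_add[OF lin'])
  then show "tensor_lift (f (xs @ (a + b) # ys)) t =
      tensor_lift (f (xs @ a # ys)) t + tensor_lift (f (xs @ b # ys)) t"
    by simp
  have "tensor_lift (f (xs @ (r *\<^sub>R a) # ys)) = (\<lambda>t. r *\<^sub>R tensor_lift (f (xs @ a # ys)) t)"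
    by (rule tensor_lift_unique)
      (auto intro: linear_compose_scale_right lin simp: tensor_lift_tens[OF f] linear_scale[OF lin'])
  then show "tensor_lift (f (xs @ (r *\<^sub>R a) # ys)) t = r *\<^sub>R tensor_lift (f (xs @ a # ys)) t"
    by simp
qed

lemma multilinear_map2:
  fixes h :: "'c \<Rightarrow> 'a::real_vector \<Rightarrow> 'b::real_vector"
  assumes "\<And>c. linear (h c)"
  shows "multilinear (\<lambda>xs. if length cs = length xs then tens (map2 h cs xs) else 0)"
  unfolding multilinear_def
proof (intro allI)
  fix xs ys :: "'a list"
  show "linear (\<lambda>a. if length cs = length (xs @ a # ys) then tens (map2 h cs (xs @ a # ys)) else 0)"
  proof (cases "length cs = length xs + Suc (length ys)")
    case True
    then obtain us c vs where cs: "cs = us @ c # vs" "length us = length xs"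
      using that[of "take (length xs) cs"] id_take_nth_drop[of "length xs" cs] by simp
    have "linear (\<lambda>b. tens (map2 h us xs @ b # map2 h vs ys))"
      using multilinear_tens unfolding multilinear_def by blast
    from linear_compose[OF assms this] show ?thesis
      using True cs by (simp add: o_def)
  qed (simp add: module_hom_zero)
qed

lemma independent_tens:
  fixes B :: "'a::real_vector set"
  assumes "independent B"
  shows "independent {tens xs | xs. set xs \<subseteq> B}"
    and "inj_on tens {xs. set xs \<subseteq> B}"
proof -
  define E where "E = extend_basis B"
  have E: "independent E" "span E = UNIV" "B \<subseteq> E"
    unfolding E_def by (simp_all add: assms independent_extend_basis span_extend_basis extend_basis_superset)
  define \<phi> where "\<phi> bs xs =
      (if length bs = length xs then \<Prod>(b, x)\<leftarrow>zip bs xs. representation E x b else 0)" for bs xs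
  have lin: "linear (\<lambda>x. representation E x b)" for b
    using E(1,2) by (simp add: linear_iff representation_add representation_scale)
  have "multilinear (\<phi> bs)" for bs
    unfolding multilinear_def
  proof (intro allI)
    fix xs ys :: "'a list"
    show "linear (\<lambda>a. \<phi> bs (xs @ a # ys))"
    proof (cases "length bs = length xs + Suc (length ys)")
      case True
      then obtain us c vs where cs: "bs = us @ c # vs" "length us = length xs"
        using that[of "take (length xs) bs"] id_take_nth_drop[of "length xs" bs] by simp
      have "(\<lambda>a. \<phi> bs (xs @ a # ys)) = (\<lambda>a. (\<phi> us xs * \<phi> vs ys) *\<^sub>R representation E a c)"
        using True cs by (auto simp: \<phi>_def)
      then show ?thesis by (simp only: linear_compose_scale_right[OF lin])
    qed (simp add: \<phi>_def module_hom_zero)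
  qed
  note lift = linear_tensor_lift[OF this] tensor_lift_tens[OF this]
  have rep: "representation E x b = (if x = b then 1 else 0)" if "x \<in> B" for x b
    using representation_basis[OF E(1)] E(3) that by auto
  have \<phi>: "\<phi> bs xs = (if xs = bs then 1 else 0)" if "set xs \<subseteq> B" for bs xs
  proof (cases "length bs = length xs")
    case True
    then show ?thesis using that
      by (induction bs xs rule: list_induct2) (auto simp: \<phi>_def rep)
  qed (auto simp: \<phi>_def)
  show "inj_on tens {xs. set xs \<subseteq> B}"
    by (rule inj_onI) (metis \<phi> lift(2) mem_Collect_eq zero_neq_one)
  show "independent {tens xs | xs. set xs \<subseteq> B}"
  proof
    assume "dependent {tens xs | xs. set xs \<subseteq> B}"
    then obtain bs where bs: "set bs \<subseteq> B"
      and sp: "tens bs \<in> span ({tens xs | xs. set xs \<subseteq> B} - {tens bs})"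
      unfolding dependent_def by blast
    have "tensor_lift (\<phi> bs) (tens bs) = 0"
      by (rule linear_eq_0_on_span[OF lift(1) _ sp]) (auto simp: lift(2) \<phi>)
    then show False by (simp add: lift(2) \<phi> bs)
  qed
qed


text \<open>The concatenation product \<open>V\<^sup>\<otimes>\<^sup>k \<times> V\<^sup>\<otimes>\<^sup>l \<rightarrow> V\<^sup>\<otimes>\<^sup>(\<^sup>k\<^sup>+\<^sup>l\<^sup>)\<close>.\<close>

definition tensor_append :: "'a::real_vector tensor \<Rightarrow> 'a tensor \<Rightarrow> 'a tensor" where
  "tensor_append s t = tensor_lift (\<lambda>xs. tensor_lift (\<lambda>ys. tens (xs @ ys)) t) s"

lemma
  fixes s t :: "'a::real_vector tensor" and xs ys :: "'a list"
  shows tensor_append_tens: "tensor_append (tens xs) (tens ys) = tens (xs @ ys)"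
    and linear_tensor_append_left: "linear (\<lambda>s. tensor_append s t)"
    and linear_tensor_append_right: "linear (tensor_append s)"
proof -
  have f: "multilinear (\<lambda>ys :: 'a list. tens (xs @ ys))" for xs
    unfolding multilinear_def
  proof (intro allI)
    fix us vs :: "'a list"
    show "linear (\<lambda>a. tens (xs @ us @ a # vs))"
      using multilinear_tens [unfolded multilinear_def, rule_format, of "xs @ us" vs] by simp
  qed
  have f': "multilinear (\<lambda>xs :: 'a list. tens (xs @ ys))" for ys
    unfolding multilinear_def
  proof (intro allI)
    fix us vs :: "'a list"
    show "linear (\<lambda>a. tens ((us @ a # vs) @ ys))"
      using multilinear_tens [unfolded multilinear_def, rule_format, of us "vs @ ys"] by simp
  qed
  have ml: "multilinear (\<lambda>xs. tensor_lift (\<lambda>ys. tens (xs @ ys)) t)" for t :: "'a tensor"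
    by (rule multilinear_tensor_lift) (rule f f')+
  show "tensor_append (tens xs) (tens ys) = tens (xs @ ys)"
    unfolding tensor_append_def tensor_lift_tens[OF ml] by (rule tensor_lift_tens[OF f])
  have left: "linear (\<lambda>s. tensor_append s t)" for t :: "'a tensor"
    unfolding tensor_append_def by (rule linear_tensor_lift[OF ml])
  have right: "linear (tensor_append (tens xs))" for xs :: "'a list"
    unfolding tensor_append_def tensor_lift_tens[OF ml] by (rule linear_tensor_lift[OF f])
  have "linear (tensor_append s)" if "s \<in> span (range tens)" for s :: "'a tensor"
    using that
  proof (induction rule: span_induct_alt)
    case base
    then show ?case by (simp add: linear_0[OF left] module_hom_zero)
  next
    case (step c x y)
    have "tensor_append (c *\<^sub>R x + y) = (\<lambda>t. c *\<^sub>R tensor_append x t + tensor_append y t)"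
      by (rule ext) (simp add: linear_add[OF left] linear_scale[OF left])
    then show ?case using step right
      by (auto intro!: linear_compose_add linear_compose_scale_right)
  qed
  then show "linear (tensor_append s)" by (simp add: span_tens)
  show "linear (\<lambda>s. tensor_append s t)" by (rule left)
qed

text \<open>\<open>f \<otimes> g\<close> on \<open>V \<otimes> V\<close>, extended by zero to the other tensor powers; the values of \<open>f\<close> and \<open>g\<close> may
  themselves lie in tensor powers.\<close>

definition tensor_map ::
  "('a::real_vector \<Rightarrow> 'b::real_vector tensor) \<Rightarrow> ('a \<Rightarrow> 'b tensor) \<Rightarrow> 'a tensor \<Rightarrow> 'b tensor" where
  "tensor_map f g = tensor_lift (\<lambda>xs. case xs of [a, b] \<Rightarrow> tensor_append (f a) (g b) | _ \<Rightarrow> 0)"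

lemma
  fixes f g :: "'a::real_vector \<Rightarrow> 'b::real_vector tensor"
  assumes "linear f" "linear g"
  shows linear_tensor_map: "linear (tensor_map f g)"
    and tensor_map_tens: "tensor_map f g (tens [a, b]) = tensor_append (f a) (g b)"
    and tensor_map_tens_zero: "length xs \<noteq> 2 \<Longrightarrow> tensor_map f g (tens xs) = 0"
proof -
  have ml: "multilinear (\<lambda>xs. case xs of [a, b] \<Rightarrow> tensor_append (f a) (g b) | _ \<Rightarrow> 0)"
    unfolding multilinear_def
  proof (intro allI)
    fix xs ys :: "'a list"
    consider y where "xs = []" "ys = [y]" | x where "xs = [x]" "ys = []" | "length xs + length ys \<noteq> 1"
      by (cases xs; cases ys) (auto simp: length_Suc_conv)
    then show "linear (\<lambda>a. case xs @ a # ys of [a, b] \<Rightarrow> tensor_append (f a) (g b) | _ \<Rightarrow> 0)"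
    proof cases
      case 1
      then show ?thesis
        using linear_compose[OF assms(1) linear_tensor_append_left] by (simp add: o_def)
    next
      case 2
      then show ?thesis
        using linear_compose[OF assms(2) linear_tensor_append_right] by (simp add: o_def)
    next
      case 3
      have "(case xs @ a # ys of [a, b] \<Rightarrow> tensor_append (f a) (g b) | _ \<Rightarrow> 0) = 0" for a
        using 3 by (auto split: list.splits simp: append_eq_Cons_conv)
      then show ?thesis by (simp add: module_hom_zero)
    qed
  qed
  show "linear (tensor_map f g)" "tensor_map f g (tens [a, b]) = tensor_append (f a) (g b)"
    unfolding tensor_map_def by (simp_all add: linear_tensor_lift[OF ml] tensor_lift_tens[OF ml])
  show "length xs \<noteq> 2 \<Longrightarrow> tensor_map f g (tens xs) = 0"
    unfolding tensor_map_def tensor_lift_tens[OF ml] by (auto split: list.splits)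
qed

text \<open>The product of the algebra \<open>A \<otimes> A\<close> (and of \<open>A\<^sup>\<otimes>\<^sup>l\<close>), determined by
  \<open>(a \<otimes> b) (c \<otimes> d) = ac \<otimes> bd\<close>.\<close>

definition tensor_times :: "'a::real_algebra_1 tensor \<Rightarrow> 'a tensor \<Rightarrow> 'a tensor" where
  "tensor_times s t = tensor_lift (\<lambda>xs. tensor_lift
     (\<lambda>ys. if length xs = length ys then tens (map2 (*) xs ys) else 0) t) s"

lemma tensor_times_tens:
  fixes xs ys :: "'a::real_algebra_1 list"
  shows "tensor_times (tens xs) (tens ys) =
     (if length xs = length ys then tens (map2 (*) xs ys) else 0)"
proof -
  have f: "multilinear (\<lambda>ys :: 'a list. if length xs = length ys then tens (map2 (*) xs ys) else 0)"
    for xs by (rule multilinear_map2) (simp add: linear_iff algebra_simps)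
  have swap: "map2 (*) xs ys = map2 (\<lambda>y x. x * y) ys xs" for xs ys :: "'a list"
    by (subst zip_commute) (simp add: o_def split_def)
  have "multilinear (\<lambda>xs :: 'a list. if length ys = length xs then tens (map2 (\<lambda>y x. x * y) ys xs) else 0)"
    for ys by (rule multilinear_map2) (simp add: linear_iff algebra_simps)
  then have f': "multilinear (\<lambda>xs :: 'a list. if length xs = length ys then tens (map2 (*) xs ys) else 0)"
    for ys unfolding swap[of _ ys] eq_commute[of _ "length ys"] .
  show ?thesis
    unfolding tensor_times_def tensor_lift_tens[OF multilinear_tensor_lift[OF f f']]
    by (rule tensor_lift_tens[OF f])
qed

text \<open>The iterated product \<open>m : A\<^sup>\<otimes>\<^sup>l \<rightarrow> A\<close>, for all \<open>l\<close> at once.\<close>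

definition tensor_prod :: "'a::real_algebra_1 tensor \<Rightarrow> 'a" where
  "tensor_prod = tensor_lift prod_list"

lemma
  fixes xs :: "'a::real_algebra_1 list"
  shows linear_tensor_prod: "linear (tensor_prod :: 'a tensor \<Rightarrow> 'a)"
    and tensor_prod_tens: "tensor_prod (tens xs) = prod_list xs"
proof -
  have ml: "multilinear (prod_list :: 'a list \<Rightarrow> 'a)"
    unfolding multilinear_def by (simp add: linear_iff algebra_simps)
  show "linear (tensor_prod :: 'a tensor \<Rightarrow> 'a)" "tensor_prod (tens xs) = prod_list xs"
    unfolding tensor_prod_def by (simp_all add: linear_tensor_lift[OF ml] tensor_lift_tens[OF ml])
qed

abbreviation tens1 :: "'a::real_vector \<Rightarrow> 'a tensor" where
  "tens1 a \<equiv> tens [a]"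


section \<open>Graded connected Hopf algebras\<close>

text \<open>The type class supplies the unital associative product; \<open>H n\<close> is the degree \<open>n\<close> subspace.\<close>

locale hopf_algebra =
  fixes \<Delta> :: "'a::real_algebra_1 \<Rightarrow> 'a tensor" and \<epsilon> :: "'a \<Rightarrow> real"
  assumes linear_coproduct: "linear \<Delta>"
    and coproduct_in: "\<And>x. \<Delta> x \<in> tensor_power TYPE('a) 2"
    and linear_counit: "linear \<epsilon>"
    and coassociative: "\<And>x. tensor_map \<Delta> tens1 (\<Delta> x) = tensor_map tens1 \<Delta> (\<Delta> x)"
    and counit_left: "\<And>x. tensor_map (\<lambda>a. \<epsilon> a *\<^sub>R tens []) tens1 (\<Delta> x) = tens1 x"
    and counit_right: "\<And>x. tensor_map tens1 (\<lambda>a. \<epsilon> a *\<^sub>R tens []) (\<Delta> x) = tens1 x"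
    and coproduct_mult: "\<And>x y. \<Delta> (x * y) = tensor_times (\<Delta> x) (\<Delta> y)"
    and coproduct_one: "\<Delta> 1 = tens [1, 1]"
    and counit_mult: "\<And>x y. \<epsilon> (x * y) = \<epsilon> x * \<epsilon> y"
    and counit_one: "\<epsilon> 1 = 1"
    and antipode: "\<exists>S. linear S \<and>
      (\<forall>x. tensor_prod (tensor_map (\<lambda>a. tens1 (S a)) tens1 (\<Delta> x)) = \<epsilon> x *\<^sub>R 1 \<and>
           tensor_prod (tensor_map tens1 (\<lambda>a. tens1 (S a)) (\<Delta> x)) = \<epsilon> x *\<^sub>R 1)"

definition graded_by :: "(nat \<Rightarrow> 'a::real_vector set) \<Rightarrow> bool" where
  "graded_by H \<longleftrightarrow> (\<forall>n. subspace (H n)) \<and>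
     (\<forall>x. \<exists>!c. finite {n. c n \<noteq> 0} \<and> (\<forall>n. c n \<in> H n) \<and> x = (\<Sum>n | c n \<noteq> 0. c n))"

definition component :: "(nat \<Rightarrow> 'a::real_vector set) \<Rightarrow> nat \<Rightarrow> 'a \<Rightarrow> 'a" where
  "component H n x =
     (THE c. finite {n. c n \<noteq> 0} \<and> (\<forall>n. c n \<in> H n) \<and> x = (\<Sum>n | c n \<noteq> 0. c n)) n"

locale graded_connected_hopf_algebra = hopf_algebra \<Delta> \<epsilon>
  for H :: "nat \<Rightarrow> 'a::real_algebra_1 set" and \<Delta> :: "'a \<Rightarrow> 'a tensor" and \<epsilon> :: "'a \<Rightarrow> real" +
  assumes graded: "graded_by H"
    and graded_mult: "\<And>i j x y. x \<in> H i \<Longrightarrow> y \<in> H j \<Longrightarrow> x * y \<in> H (i + j)"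
    and graded_coproduct: "\<And>n x. x \<in> H n \<Longrightarrow>
      \<Delta> x \<in> span {tens [a, b] | a b i j. i + j = n \<and> a \<in> H i \<and> b \<in> H j}"
    and graded_counit: "\<And>n x. n > 0 \<Longrightarrow> x \<in> H n \<Longrightarrow> \<epsilon> x = 0"
    and connected: "H 0 = span {1}"

text \<open>Compatibility with the antipodes is automatic for bialgebra morphisms of Hopf algebras.\<close>

definition hopf_morphism ::
  "('a::real_algebra_1 \<Rightarrow> 'a tensor) \<Rightarrow> ('a \<Rightarrow> real) \<Rightarrow>
   ('b::real_algebra_1 \<Rightarrow> 'b tensor) \<Rightarrow> ('b \<Rightarrow> real) \<Rightarrow> ('a \<Rightarrow> 'b) \<Rightarrow> bool" where
  "hopf_morphism \<Delta> \<epsilon> \<Delta>' \<epsilon>' f \<longleftrightarrow> linear f \<and>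
     (\<forall>x y. f (x * y) = f x * f y) \<and> f 1 = 1 \<and>
     (\<forall>x. \<Delta>' (f x) = tensor_map (\<lambda>a. tens1 (f a)) (\<lambda>a. tens1 (f a)) (\<Delta> x)) \<and>
     (\<forall>x. \<epsilon>' (f x) = \<epsilon> x)"

definition graded_basis :: "(nat \<Rightarrow> 'a::real_vector set) \<Rightarrow> (nat \<Rightarrow> 'a set) \<Rightarrow> bool" where
  "graded_basis H B \<longleftrightarrow> (\<forall>n. finite (B n) \<and> independent (B n) \<and> span (B n) = H n)"


section \<open>Descent operators\<close>

text \<open>\<open>\<Delta>\<^sup>[\<^sup>l\<^sup>] : A \<rightarrow> A\<^sup>\<otimes>\<^sup>l\<close>; \<open>l = 0\<close> and \<open>l = 1\<close> give the counit and the identity.\<close>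

fun iterated_coproduct ::
  "('a::real_vector \<Rightarrow> 'a tensor) \<Rightarrow> ('a \<Rightarrow> real) \<Rightarrow> nat \<Rightarrow> 'a \<Rightarrow> 'a tensor" where
  "iterated_coproduct \<Delta> \<epsilon> 0 x = \<epsilon> x *\<^sub>R tens []"
| "iterated_coproduct \<Delta> \<epsilon> (Suc 0) x = tens1 x"
| "iterated_coproduct \<Delta> \<epsilon> (Suc (Suc l)) x =
     tensor_map tens1 (iterated_coproduct \<Delta> \<epsilon> (Suc l)) (\<Delta> x)"

definition graded_projection ::
  "(nat \<Rightarrow> 'a::real_vector set) \<Rightarrow> nat list \<Rightarrow> 'a tensor \<Rightarrow> 'a tensor" where
  "graded_projection H D = tensor_lift
     (\<lambda>xs. if length xs = length D then tens (map2 (component H) D xs) else 0)"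

definition coproduct_comp ::
  "(nat \<Rightarrow> 'a::real_vector set) \<Rightarrow> ('a \<Rightarrow> 'a tensor) \<Rightarrow> ('a \<Rightarrow> real) \<Rightarrow> nat list \<Rightarrow> 'a \<Rightarrow> 'a tensor" where
  "coproduct_comp H \<Delta> \<epsilon> D x = graded_projection H D (iterated_coproduct \<Delta> \<epsilon> (length D) x)"

definition weak_compositions :: "nat \<Rightarrow> nat list set" where
  "weak_compositions n = {D. sum_list D = n}"

definition multinomial :: "nat list \<Rightarrow> real" where
  "multinomial D = fact (sum_list D) / prod_list (map fact D)"

abbreviation basis_union :: "(nat \<Rightarrow> 'a set) \<Rightarrow> 'a set" where
  "basis_union B \<equiv> (\<Union>n. B n)"

text \<open>
  \<open>m \<circ> \<Delta>\<^sub>P\<close> on \<open>H n\<close>. There are infinitely many weak-compositions of \<open>n\<close>, since parts may vanish, so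
  for general \<open>P\<close> the sum over \<open>D\<close> is a series in the finite-dimensional space \<open>H n\<close>; it is
  taken coefficientwise in the basis \<open>B n\<close>.
\<close>

definition descent_operator ::
  "(nat \<Rightarrow> 'a::real_algebra_1 set) \<Rightarrow> ('a \<Rightarrow> 'a tensor) \<Rightarrow> ('a \<Rightarrow> real) \<Rightarrow> (nat \<Rightarrow> 'a set) \<Rightarrow>
   nat \<Rightarrow> nat list pmf \<Rightarrow> 'a \<Rightarrow> 'a" where
  "descent_operator H \<Delta> \<epsilon> B n P x =
     (\<Sum>y\<in>B n. (\<Sum>\<^sub>\<infinity>D\<in>weak_compositions n. pmf P D / multinomial D *
        representation (basis_union B) (tensor_prod (coproduct_comp H \<Delta> \<epsilon> D x)) y) *\<^sub>R y)"

definition descent_chain_conditions ::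
  "('a::real_algebra_1 \<Rightarrow> 'a tensor) \<Rightarrow> (nat \<Rightarrow> 'a set) \<Rightarrow> bool" where
  "descent_chain_conditions \<Delta> B \<longleftrightarrow>
     card (B 1) = 1 \<and>
     (\<forall>w\<in>basis_union B. \<forall>z\<in>basis_union B. \<forall>y\<in>basis_union B.
        representation (basis_union B) (w * z) y \<ge> 0) \<and>
     (\<forall>x\<in>basis_union B. \<forall>w\<in>basis_union B. \<forall>z\<in>basis_union B.
        representation {tens [u, v] | u v. u \<in> basis_union B \<and> v \<in> basis_union B}
          (\<Delta> x) (tens [w, z]) \<ge> 0) \<and>
     (\<forall>n>1. \<forall>x\<in>B n. \<Delta> x \<noteq> tens [1, x] + tens [x, 1])"


section \<open>Markov chains and the Doob transform\<close>

definition rescaling ::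
  "(nat \<Rightarrow> 'a::real_algebra_1 set) \<Rightarrow> ('a \<Rightarrow> 'a tensor) \<Rightarrow> ('a \<Rightarrow> real) \<Rightarrow> (nat \<Rightarrow> 'a set) \<Rightarrow>
   nat \<Rightarrow> 'a \<Rightarrow> real" where
  "rescaling H \<Delta> \<epsilon> B n x =
     representation {tens xs | xs. length xs = n \<and> set xs \<subseteq> basis_union B}
       (coproduct_comp H \<Delta> \<epsilon> (replicate n 1) x) (tens (replicate n (the_elem (B 1))))"

definition doob_matrix ::
  "(nat \<Rightarrow> 'a::real_algebra_1 set) \<Rightarrow> ('a \<Rightarrow> 'a tensor) \<Rightarrow> ('a \<Rightarrow> real) \<Rightarrow> (nat \<Rightarrow> 'a set) \<Rightarrow>
   nat \<Rightarrow> nat list pmf \<Rightarrow> 'a \<Rightarrow> 'a \<Rightarrow> real" where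
  "doob_matrix H \<Delta> \<epsilon> B n P x y =
     representation (basis_union B) (descent_operator H \<Delta> \<epsilon> B n P x) y
       * (rescaling H \<Delta> \<epsilon> B n y / rescaling H \<Delta> \<epsilon> B n x)"

definition transition_matrix :: "'s set \<Rightarrow> ('s \<Rightarrow> 's \<Rightarrow> real) \<Rightarrow> bool" where
  "transition_matrix \<Omega> K \<longleftrightarrow> finite \<Omega> \<and>
     (\<forall>x\<in>\<Omega>. \<forall>y\<in>\<Omega>. K x y \<ge> 0) \<and> (\<forall>x\<in>\<Omega>. (\<Sum>y\<in>\<Omega>. K x y) = 1)"

definition markov_chain ::
  "'w measure \<Rightarrow> (nat \<Rightarrow> 'w \<Rightarrow> 's) \<Rightarrow> 's set \<Rightarrow> ('s \<Rightarrow> 's \<Rightarrow> real) \<Rightarrow> bool" where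
  "markov_chain M X \<Omega> K \<longleftrightarrow> prob_space M \<and> transition_matrix \<Omega> K \<and>
     (\<forall>t. X t \<in> M \<rightarrow>\<^sub>M count_space \<Omega>) \<and>
     (\<forall>t x. (\<forall>i\<le>Suc t. x i \<in> \<Omega>) \<longrightarrow> \<P>(\<omega> in M. \<forall>i\<le>t. X i \<omega> = x i) \<noteq> 0 \<longrightarrow>
        \<P>(\<omega> in M. X (Suc t) \<omega> = x (Suc t) \<bar> \<forall>i\<le>t. X i \<omega> = x i) = K (x t) (x (Suc t)))"

text \<open>
  The chain on \<open>\<Omega>\<close> with transition matrix \<open>K\<close>, started at \<open>X0\<close>, lumps weakly via \<open>\<theta>\<close> to a chain on \<open>\<Omega>'\<close>
  with transition matrix \<open>K'\<close>. The statement quantifies over all realisations of the chain on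
  probability spaces of a given type; the type is an argument only so that it can stay arbitrary.
\<close>

definition lumps_weakly ::
  "'w itself \<Rightarrow> 's set \<Rightarrow> ('s \<Rightarrow> 's \<Rightarrow> real) \<Rightarrow> 's pmf \<Rightarrow> ('s \<Rightarrow> 'r) \<Rightarrow> 'r set \<Rightarrow> ('r \<Rightarrow> 'r \<Rightarrow> real) \<Rightarrow> bool"
  where
  "lumps_weakly _ \<Omega> K X0 \<theta> \<Omega>' K' \<longleftrightarrow>
     transition_matrix \<Omega> K \<and> transition_matrix \<Omega>' K' \<and> \<theta> ` \<Omega> = \<Omega>' \<and>
     (\<forall>(M :: 'w measure) X. markov_chain M X \<Omega> K \<longrightarrow>
        (\<forall>x\<in>\<Omega>. \<P>(\<omega> in M. X 0 \<omega> = x) = pmf X0 x) \<longrightarrow>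
        markov_chain M (\<lambda>t \<omega>. \<theta> (X t \<omega>)) \<Omega>' K')"

end

theory Submission
  imports Defs
begin

text \<open>
  Let \<open>\<lambda>\<close> be the coefficient of \<open>\<bullet>\<close>. It satisfies \<open>\<lambda>(xy) = \<lambda>(x)\<epsilon>(y) + \<epsilon>(x)\<lambda>(y)\<close>, and \<open>\<eta>\<close> on \<open>H\<^sub>n\<close> is its \<open>n\<close>-th
  convolution power. The binomial formula for convolution powers of a derivation on products, together with
  coassociativity, gives \<open>\<eta> \<circ> m \<circ> \<Delta>\<^sub>D = multinomial(D) \<eta>\<close>, and positivity of \<open>\<eta>\<close> follows by induction on the degree
  from (iii). The Hopf morphism \<open>f = \<theta>\<^sup>*\<close> commutes with \<open>m \<circ> \<Delta>\<^sub>D\<close> and satisfies \<open>\<eta> \<circ> f = \<eta>'\<close>; comparing coefficients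
  of \<open>y\<close>, the sum of \<open>K(x, y)\<close> over a fibre \<open>\<theta> x = x'\<close> is \<open>K'(x', \<theta> y)\<close>. Hence, conditionally on
  \<open>\<theta> X\<^sub>0, \<dots>, \<theta> X\<^sub>t\<close>, the state \<open>X\<^sub>t\<close> remains distributed proportionally to \<open>\<eta>\<close> on its fibre, and so the next lumped
  state depends only on \<open>\<theta> X\<^sub>t\<close>. Surjectivity of \<open>\<theta>\<close> holds since \<open>\<eta>' = \<eta> \<circ> f\<close> does not vanish on \<open>B'\<^sub>n\<close>.
\<close>

section \<open>Tensor powers and nonnegative cones\<close>

lemma linear_compose': "linear g \<Longrightarrow> linear f \<Longrightarrow> linear (\<lambda>x. f (g x))"
  using linear_compose[of g f] by (simp add: o_def)

lemma tensor_eqI: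
  assumes "linear g" "linear h" "\<And>xs. g (tens xs) = h (tens xs)"
  shows "g t = h t"
  using linear_eq_on_tens[OF assms] by simp

lemma linear_tens: "linear (\<lambda>a. tens (xs @ a # ys))"
  using multilinear_tens[unfolded multilinear_def, rule_format] .

lemmas tens_add = linear_add[OF linear_tens] and tens_scale = linear_scale[OF linear_tens]

lemma tensor_append_tens1: "tensor_append (tens [a]) (tens xs) = tens (a # xs)"
  by (simp add: tensor_append_tens)

lemma linear_tens1: "linear tens1"
  using linear_tens[of "[]" "[]"] by simp

lemma linear_tens2: "linear (\<lambda>a. tens [a, b])" "linear (\<lambda>b. tens [a, b])"
  using linear_tens[of "[]" "[b]"] linear_tens[of "[a]" "[]"] by simp_all

section \<open>Evaluating tensors on lists of functionals\<close>

text \<open>This is \<open>\<phi>_1 \<otimes> ... \<otimes> \<phi>_l\<close> on the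
  \<open>l\<close>-th tensor power, extended by zero to the other powers. Such functionals turn the
  coalgebra axioms into identities for convolution.\<close>

definition tensor_eval :: "('a::real_vector \<Rightarrow> real) list \<Rightarrow> 'a tensor \<Rightarrow> real" where
  "tensor_eval \<phi>s = tensor_lift
     (\<lambda>xs. if length \<phi>s = length xs then prod_list (map2 (\<lambda>\<phi> x. \<phi> x) \<phi>s xs) else 0)"

lemma
  assumes "\<forall>\<phi>\<in>set \<phi>s. linear \<phi>"
  shows linear_tensor_eval: "linear (tensor_eval \<phi>s)"
    and tensor_eval_tens: "tensor_eval \<phi>s (tens xs) =
      (if length \<phi>s = length xs then prod_list (map2 (\<lambda>\<phi> x. \<phi> x) \<phi>s xs) else 0)"
proof -
  let ?f = "\<lambda>xs. if length \<phi>s = length xs then prod_list (map2 (\<lambda>\<phi> x. \<phi> x) \<phi>s xs) else 0"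
  have "multilinear ?f"
    unfolding multilinear_def
  proof (intro allI)
    fix xs ys :: "'a list"
    show "linear (\<lambda>a. ?f (xs @ a # ys))"
    proof (cases "length \<phi>s = length xs + Suc (length ys)")
      case True
      then obtain us c vs where cs: "\<phi>s = us @ c # vs" "length us = length xs"
        using that[of "take (length xs) \<phi>s"] id_take_nth_drop[of "length xs" \<phi>s] by simp
      \<comment> \<open>Only the factor \<open>c\<close> meets the varying letter; the factors
        before and after it form a constant scalar.\<close>
      have "(\<lambda>a. ?f (xs @ a # ys)) = (\<lambda>a.
          (prod_list (map2 (\<lambda>\<phi> x. \<phi> x) us xs) * prod_list (map2 (\<lambda>\<phi> x. \<phi> x) vs ys)) *\<^sub>R c a)"
        using True cs by auto
      moreover have "linear c" using assms cs by simp
      ultimately show ?thesis by (simp only: linear_compose_scale_right)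
    qed (simp add: module_hom_zero)
  qed
  then show "linear (tensor_eval \<phi>s)" "tensor_eval \<phi>s (tens xs) = ?f xs"
    unfolding tensor_eval_def by (simp_all add: linear_tensor_lift tensor_lift_tens)
qed

lemma tensor_power_induct [consumes 1, case_names base step]:
  fixes t :: "'a::real_vector tensor"
  assumes "t \<in> tensor_power TYPE('a) l" "P 0"
    "\<And>c xs t. length xs = l \<Longrightarrow> P t \<Longrightarrow> P (c *\<^sub>R tens xs + t)"
  shows "P t"
  using assms(1) unfolding tensor_power_def
  by (induction rule: span_induct_alt) (use assms(2,3) in auto)

text \<open>Homogeneity of \<open>s\<close> fixes where a concatenated word is cut: a word of
  another length in \<open>s\<close> could still reach the total length after appending, and then
  the left side need not vanish with the right one.\<close>

lemma tensor_eval_append: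
  fixes s t :: "'a::real_vector tensor"
  assumes s: "s \<in> tensor_power TYPE('a) (length \<phi>s)"
    and lin: "\<forall>\<phi>\<in>set \<phi>s. linear \<phi>" "\<forall>\<phi>\<in>set \<psi>s. linear \<phi>"
  shows "tensor_eval (\<phi>s @ \<psi>s) (tensor_append s t) = tensor_eval \<phi>s s * tensor_eval \<psi>s t"
proof -
  have lin': "\<forall>\<phi>\<in>set (\<phi>s @ \<psi>s). linear \<phi>" using lin by auto
  note L = linear_tensor_eval[OF lin'] and L1 = linear_tensor_eval[OF lin(1)]
    and L2 = linear_tensor_eval[OF lin(2)] and A = linear_tensor_append_left
  have *: "tensor_eval (\<phi>s @ \<psi>s) (tensor_append (tens xs) t) = tensor_eval \<phi>s (tens xs) * tensor_eval \<psi>s t"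
    if "length xs = length \<phi>s" for xs
  proof (rule tensor_eqI[of _ _ t])
    show "linear (\<lambda>t. tensor_eval (\<phi>s @ \<psi>s) (tensor_append (tens xs) t))"
      by (rule linear_compose'[OF linear_tensor_append_right L])
    show "linear (\<lambda>t. tensor_eval \<phi>s (tens xs) * tensor_eval \<psi>s t)"
      using linear_compose_scale_right[OF L2] by simp
  qed (use that in \<open>simp add: tensor_append_tens tensor_eval_tens[OF lin'] tensor_eval_tens[OF lin(1)]
      tensor_eval_tens[OF lin(2)]\<close>)
  show ?thesis using s
    by (induction rule: tensor_power_induct)
      (simp_all add: linear_0[OF L] linear_0[OF L1] linear_0[OF A] linear_add[OF L] linear_add[OF L1]
        linear_add[OF A] linear_scale[OF L] linear_scale[OF L1] linear_scale[OF A] * algebra_simps)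
qed

lemma tens_in_tensor_power:
  fixes xs :: "'a::real_vector list"
  shows "length xs = l \<Longrightarrow> tens xs \<in> tensor_power TYPE('a) l"
  unfolding tensor_power_def by (intro span_base) auto

text \<open>For pure \<open>s\<close> the product is a lift, hence linear in \<open>t\<close>.
  Linearity in \<open>s\<close> comes from the outer lift and carries this over to all
  \<open>s\<close> by induction over the span of the pure tensors.\<close>

lemma
  fixes s t :: "'a::real_algebra_1 tensor"
  shows linear_tensor_times_left: "linear (\<lambda>s. tensor_times s t)"
    and linear_tensor_times_right: "linear (tensor_times s)"
proof -
  have f: "multilinear (\<lambda>ys :: 'a list. if length xs = length ys then tens (map2 (*) xs ys) else 0)"
    for xs by (rule multilinear_map2) (simp add: linear_iff algebra_simps)
  have swap: "map2 (*) xs ys = map2 (\<lambda>y x. x * y) ys xs" for xs ys :: "'a list"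
    by (subst zip_commute) (simp add: o_def split_def)
  have "multilinear (\<lambda>xs :: 'a list. if length ys = length xs then tens (map2 (\<lambda>y x. x * y) ys xs) else 0)"
    for ys by (rule multilinear_map2) (simp add: linear_iff algebra_simps)
  then have f': "multilinear (\<lambda>xs :: 'a list. if length xs = length ys then tens (map2 (*) xs ys) else 0)"
    for ys unfolding swap[of _ ys] eq_commute[of _ "length ys"] .
  note ml = multilinear_tensor_lift[OF f f']
  have left: "linear (\<lambda>s. tensor_times s t)" for t :: "'a tensor"
    unfolding tensor_times_def by (rule linear_tensor_lift[OF ml])
  then show "linear (\<lambda>s. tensor_times s t)" .
  have right: "linear (tensor_times (tens xs))" for xs :: "'a list"
    unfolding tensor_times_def tensor_lift_tens[OF ml] by (rule linear_tensor_lift[OF f])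
  have "s \<in> span (range tens)" by (simp add: span_tens)
  then show "linear (tensor_times s)"
  proof (induction rule: span_induct_alt)
    case base
    then show ?case by (simp add: linear_0[OF left] module_hom_zero)
  next
    case (step c x y)
    have "tensor_times (c *\<^sub>R x + y) = (\<lambda>t. c *\<^sub>R tensor_times x t + tensor_times y t)"
      by (rule ext) (simp add: linear_add[OF left] linear_scale[OF left])
    then show ?case using step right
      by (auto intro!: linear_compose_add linear_compose_scale_right)
  qed
qed

text \<open>The induced map \<open>f \<otimes> ... \<otimes> f\<close> on all tensor powers at
  once.\<close>

definition tensor_functor :: "('a::real_vector \<Rightarrow> 'b::real_vector) \<Rightarrow> 'a tensor \<Rightarrow> 'b tensor" where
  "tensor_functor f = tensor_lift (\<lambda>xs. tens (map f xs))"

lemma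
  assumes "linear f"
  shows linear_tensor_functor: "linear (tensor_functor f)"
    and tensor_functor_tens: "tensor_functor f (tens xs) = tens (map f xs)"
proof -
  have "multilinear (\<lambda>xs. tens (map f xs))"
    unfolding multilinear_def
    by (auto intro!: linearI simp: linear_add[OF assms] linear_scale[OF assms] tens_add tens_scale)
  then show "linear (tensor_functor f)" "tensor_functor f (tens xs) = tens (map f xs)"
    unfolding tensor_functor_def by (simp_all add: linear_tensor_lift tensor_lift_tens)
qed

lemma tensor_functor_append_tens:
  assumes "linear f"
  shows "tensor_functor f (tensor_append (tens xs) t) = tensor_append (tens (map f xs)) (tensor_functor f t)"
proof (rule tensor_eqI[of _ _ t])
  note F = linear_tensor_functor[OF assms] and A = linear_tensor_append_right
  show "linear (\<lambda>t. tensor_functor f (tensor_append (tens xs) t))"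
    by (rule linear_compose'[OF A F])
  show "linear (\<lambda>t. tensor_append (tens (map f xs)) (tensor_functor f t))"
    by (rule linear_compose'[OF F A])
qed (simp add: tensor_append_tens tensor_functor_tens[OF assms])

lemma tens_map_scale: "tens (map2 (\<lambda>c x. c *\<^sub>R x) cs xs) = prod_list cs *\<^sub>R tens xs"
  if "length cs = length xs"
proof -
  \<comment> \<open>The prefix \<open>us\<close> is generalised for the induction: it absorbs the
    scaled first letter before the remaining scalars are pulled out.\<close>
  have "tens (us @ map2 (\<lambda>c x. c *\<^sub>R x) cs xs) = prod_list cs *\<^sub>R tens (us @ xs)" for us
    using that
  proof (induction cs xs arbitrary: us rule: list_induct2)
    case (Cons c cs x xs)
    then show ?case using Cons(2)[of "us @ [c *\<^sub>R x]"] by (simp add: tens_scale)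
  qed simp
  from this[of "[]"] show ?thesis by simp
qed

section \<open>Cones of nonnegative combinations\<close>

text \<open>The convex cone generated by \<open>S\<close>. Signs can be carried through linear maps
  by induction over this set, whether the generators are independent or not.\<close>

inductive_set nonneg_span :: "'a::real_vector set \<Rightarrow> 'a set" for S where
  zero: "0 \<in> nonneg_span S"
| step: "a \<ge> 0 \<Longrightarrow> x \<in> S \<Longrightarrow> y \<in> nonneg_span S \<Longrightarrow> a *\<^sub>R x + y \<in> nonneg_span S"

lemma nonneg_span_base: "x \<in> S \<Longrightarrow> x \<in> nonneg_span S"
  using nonneg_span.step[of 1 x S 0] nonneg_span.zero[of S] by simp

lemma nonneg_span_add: "x \<in> nonneg_span S \<Longrightarrow> y \<in> nonneg_span S \<Longrightarrow> x + y \<in> nonneg_span S"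
  by (induction rule: nonneg_span.induct) (auto simp: add.assoc intro: nonneg_span.step)

lemma nonneg_span_scale: "x \<in> nonneg_span S \<Longrightarrow> a \<ge> 0 \<Longrightarrow> a *\<^sub>R x \<in> nonneg_span S"
proof (induction rule: nonneg_span.induct)
  case (step b x y)
  then show ?case using nonneg_span.step[of "a * b" x S "a *\<^sub>R y"] by (simp add: algebra_simps)
qed (simp add: nonneg_span.zero)

lemma nonneg_span_sum: "(\<And>i. i \<in> I \<Longrightarrow> f i \<in> nonneg_span S) \<Longrightarrow> sum f I \<in> nonneg_span S"
  by (induction I rule: infinite_finite_induct) (auto intro: nonneg_span_add nonneg_span.zero)

lemma nonneg_span_linear_image:
  assumes "linear f" "x \<in> nonneg_span S" "\<And>s. s \<in> S \<Longrightarrow> f s \<in> nonneg_span T"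
  shows "f x \<in> nonneg_span T"
  using assms(2)
  by induction (simp_all add: linear_0[OF assms(1)] linear_add[OF assms(1)] linear_scale[OF assms(1)]
      nonneg_span.zero nonneg_span_add nonneg_span_scale assms(3))

lemma nonneg_span_linear_nonneg:
  fixes f :: "'a::real_vector \<Rightarrow> real"
  assumes "linear f" "x \<in> nonneg_span S" "\<And>s. s \<in> S \<Longrightarrow> f s \<ge> 0"
  shows "f x \<ge> 0"
  using assms(2)
  by induction (simp_all add: linear_0[OF assms(1)] linear_add[OF assms(1)] linear_scale[OF assms(1)] assms(3))

text \<open>Entrance to the cone: it converts conditions (i) and (ii), which speak of coefficients
  in a basis, into membership. The way back to signs is \<open>nonneg_span_linear_nonneg\<close>,
  applied to coordinate functionals and to convolutions of them.\<close>

lemma nonneg_span_if_representation_nonneg: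
  assumes "independent S" "x \<in> span S" "\<And>s. s \<in> S \<Longrightarrow> representation S x s \<ge> 0"
  shows "x \<in> nonneg_span S"
proof -
  have "x = (\<Sum>b | representation S x b \<noteq> 0. representation S x b *\<^sub>R b)"
    using sum_nonzero_representation_eq[OF assms(1,2)] by simp
  also have "\<dots> \<in> nonneg_span S"
  proof (rule nonneg_span_sum)
    fix b assume "b \<in> {b. representation S x b \<noteq> 0}"
    then have "b \<in> S" using representation_ne_zero by blast
    then show "representation S x b *\<^sub>R b \<in> nonneg_span S"
      by (intro nonneg_span_scale nonneg_span_base assms(3))
  qed
  finally show ?thesis .
qed

lemma nonneg_span_append:
  assumes "s \<in> nonneg_span {tens xs | xs. length xs = k \<and> set xs \<subseteq> B}"
    and "t \<in> nonneg_span {tens xs | xs. length xs = l \<and> set xs \<subseteq> B}"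
  shows "tensor_append s t \<in> nonneg_span {tens xs | xs. length xs = k + l \<and> set xs \<subseteq> B}"
proof (rule nonneg_span_linear_image[OF linear_tensor_append_left assms(1)], clarify)
  fix xs assume xs: "k = length xs" "set xs \<subseteq> B"
  show "tensor_append (tens xs) t \<in> nonneg_span {tens ys | ys. length ys = length xs + l \<and> set ys \<subseteq> B}"
  proof (rule nonneg_span_linear_image[OF linear_tensor_append_right assms(2)], clarify)
    fix ys assume "l = length ys" "set ys \<subseteq> B"
    then have "length (xs @ ys) = length xs + length ys \<and> set (xs @ ys) \<subseteq> B" using xs by simp
    then show "tensor_append (tens xs) (tens ys)
        \<in> nonneg_span {tens zs | zs. length zs = length xs + length ys \<and> set zs \<subseteq> B}"
      unfolding tensor_append_tens by (intro nonneg_span_base) blast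
  qed
qed

section \<open>Functionals on tensor maps and on products of tensors\<close>

lemma tensor_eval_singleton: "linear \<tau> \<Longrightarrow> tensor_eval [\<tau>] (tens1 b) = \<tau> b"
  by (subst tensor_eval_tens) simp_all

lemma tensor_eval_pair: "linear \<phi> \<Longrightarrow> linear \<psi> \<Longrightarrow> tensor_eval [\<phi>, \<psi>] (tens [a, b]) = \<phi> a * \<psi> b"
  by (subst tensor_eval_tens) simp_all

text \<open>The functionals are pulled back along \<open>F \<otimes> G\<close>; since all values of
  \<open>F\<close> lie in one tensor power, the cut between the two lists is unambiguous. This is
  the tool that translates coassociativity and the counit axioms.\<close>

lemma tensor_eval_map:
  fixes F G :: "'a::real_vector \<Rightarrow> 'b::real_vector tensor"
  assumes FG: "linear F" "linear G" and F: "\<And>a. F a \<in> tensor_power TYPE('b) (length \<phi>s)"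
    and lin: "\<forall>\<phi>\<in>set \<phi>s. linear \<phi>" "\<forall>\<phi>\<in>set \<psi>s. linear \<phi>"
  shows "tensor_eval (\<phi>s @ \<psi>s) (tensor_map F G t) =
    tensor_eval [\<lambda>a. tensor_eval \<phi>s (F a), \<lambda>b. tensor_eval \<psi>s (G b)] t"
proof (rule tensor_eqI[of _ _ t])
  have lin': "\<forall>\<phi>\<in>set (\<phi>s @ \<psi>s). linear \<phi>" using lin by auto
  have lin2: "\<forall>\<phi>\<in>set [\<lambda>a. tensor_eval \<phi>s (F a), \<lambda>b. tensor_eval \<psi>s (G b)]. linear \<phi>"
    using linear_compose'[OF FG(1) linear_tensor_eval[OF lin(1)]]
      linear_compose'[OF FG(2) linear_tensor_eval[OF lin(2)]] by simp
  note L = linear_tensor_eval[OF lin']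
  show "linear (\<lambda>t. tensor_eval (\<phi>s @ \<psi>s) (tensor_map F G t))"
    by (rule linear_compose'[OF linear_tensor_map[OF FG] L])
  show "linear (\<lambda>t. tensor_eval [\<lambda>a. tensor_eval \<phi>s (F a), \<lambda>b. tensor_eval \<psi>s (G b)] t)"
    by (rule linear_tensor_eval[OF lin2])
  fix xs :: "'a list"
  show "tensor_eval (\<phi>s @ \<psi>s) (tensor_map F G (tens xs)) =
      tensor_eval [\<lambda>a. tensor_eval \<phi>s (F a), \<lambda>b. tensor_eval \<psi>s (G b)] (tens xs)"
  proof (cases "length xs = 2")
    case True
    then obtain a b where "xs = [a, b]" by (auto simp: length_Suc_conv numeral_2_eq_2)
    then show ?thesis
      by (simp add: tensor_map_tens[OF FG] tensor_eval_append[OF F lin] tensor_eval_tens[OF lin2])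
  qed (simp add: tensor_map_tens_zero[OF FG] linear_0[OF L] tensor_eval_tens[OF lin2])
qed

text \<open>If \<open>\<phi>\<close> and \<open>\<psi>\<close> expand on products into sums of
  products, so does \<open>\<phi> \<otimes> \<psi>\<close> on the algebra of two-fold tensors. It is
  meant for a derivation \<open>\<phi>\<close>, with two terms, and a convolution power
  \<open>\<psi>\<close>, with a binomial expansion.\<close>

lemma tensor_eval_times:
  fixes \<phi> \<psi> :: "'a::real_algebra_1 \<Rightarrow> real"
  assumes lin: "linear \<phi>" "linear \<psi>" "\<And>p. linear (\<alpha> p)" "\<And>p. linear (\<alpha>' p)"
      "\<And>q. linear (\<beta> q)" "\<And>q. linear (\<beta>' q)"
    and \<phi>: "\<And>a c. \<phi> (a * c) = (\<Sum>p\<in>I. \<alpha> p a * \<alpha>' p c)"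
    and \<psi>: "\<And>a c. \<psi> (a * c) = (\<Sum>q\<in>J. k q * (\<beta> q a * \<beta>' q c))"
  shows "tensor_eval [\<phi>, \<psi>] (tensor_times s t) =
    (\<Sum>p\<in>I. \<Sum>q\<in>J. k q * (tensor_eval [\<alpha> p, \<beta> q] s * tensor_eval [\<alpha>' p, \<beta>' q] t))"
    (is "?l s t = ?r s t")
proof -
  have l: "\<forall>\<tau>\<in>set [\<phi>, \<psi>]. linear \<tau>" using lin by simp
  have l1: "\<forall>\<tau>\<in>set [\<alpha> p, \<beta> q]. linear \<tau>" for p q using lin by simp
  have l2: "\<forall>\<tau>\<in>set [\<alpha>' p, \<beta>' q]. linear \<tau>" for p q using lin by simp
  note L = linear_tensor_eval[OF l] and L1 = linear_tensor_eval[OF l1] and L2 = linear_tensor_eval[OF l2]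
  have base: "?l (tens xs) (tens ys) = ?r (tens xs) (tens ys)" for xs ys
  proof (cases "length xs = 2 \<and> length ys = 2")
    case True
    then obtain a b c d where "xs = [a, b]" "ys = [c, d]"
      by (auto simp: length_Suc_conv numeral_2_eq_2)
    then show ?thesis
      by (simp add: tensor_times_tens tensor_eval_tens[OF l] tensor_eval_tens[OF l1]
          tensor_eval_tens[OF l2] \<phi> \<psi> sum_product algebra_simps)
  next
    case False
    then show ?thesis
      by (auto simp: tensor_times_tens tensor_eval_tens[OF l] tensor_eval_tens[OF l1]
          tensor_eval_tens[OF l2] linear_0[OF L])
  qed
  have "?l (tens xs) t = ?r (tens xs) t" for xs
  proof (rule tensor_eqI[of "?l (tens xs)" "?r (tens xs)" t])
    show "?l (tens xs) (tens ys) = ?r (tens xs) (tens ys)" for ys by (rule base)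
    show "linear (?l (tens xs))"
      by (rule linear_compose'[OF linear_tensor_times_right L])
    show "linear (?r (tens xs))"
      by (rule linearI) (simp_all add: linear_add[OF L2] linear_scale[OF L2] algebra_simps
          sum.distrib sum_distrib_left)
  qed
  then show ?thesis
  proof (intro tensor_eqI[of "\<lambda>s. ?l s t" "\<lambda>s. ?r s t" s])
    show "linear (\<lambda>s. ?l s t)"
      by (rule linear_compose'[OF linear_tensor_times_left L])
    show "linear (\<lambda>s. ?r s t)"
      by (rule linearI) (simp_all add: linear_add[OF L1] linear_scale[OF L1] algebra_simps
          sum.distrib sum_distrib_left)
  qed
qed

section \<open>Convolution of functionals\<close>

context hopf_algebra
begin

definition conv :: "('a \<Rightarrow> real) \<Rightarrow> ('a \<Rightarrow> real) \<Rightarrow> 'a \<Rightarrow> real" where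
  "conv \<phi> \<psi> x = tensor_eval [\<phi>, \<psi>] (\<Delta> x)"

lemma linear_conv: "linear \<phi> \<Longrightarrow> linear \<psi> \<Longrightarrow> linear (conv \<phi> \<psi>)"
  unfolding conv_def by (intro linear_compose'[OF linear_coproduct linear_tensor_eval]) simp

lemma linear_convs: "\<forall>\<phi>\<in>set \<phi>s. linear \<phi> \<Longrightarrow> linear (foldr conv \<phi>s \<epsilon>)"
  by (induction \<phi>s) (auto intro: linear_conv linear_counit)

text \<open>The two bracketings evaluate \<open>\<phi> \<otimes> \<psi> \<otimes> \<tau>\<close> on
  the two sides of the coassociativity axiom.\<close>

lemma conv_assoc:
  assumes "linear \<phi>" "linear \<psi>" "linear \<tau>"
  shows "conv (conv \<phi> \<psi>) \<tau> = conv \<phi> (conv \<psi> \<tau>)"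
proof
  fix x
  have "conv (conv \<phi> \<psi>) \<tau> x = tensor_eval ([\<phi>, \<psi>] @ [\<tau>]) (tensor_map \<Delta> tens1 (\<Delta> x))"
    using assms by (subst tensor_eval_map)
      (simp_all add: linear_coproduct linear_tens1 coproduct_in numeral_2_eq_2[symmetric]
        tensor_eval_singleton conv_def[abs_def])
  also have "\<dots> = tensor_eval ([\<phi>] @ [\<psi>, \<tau>]) (tensor_map tens1 \<Delta> (\<Delta> x))"
    by (simp add: coassociative)
  also have "\<dots> = conv \<phi> (conv \<psi> \<tau>) x"
    using assms by (subst tensor_eval_map)
      (simp_all add: linear_coproduct linear_tens1 tens_in_tensor_power tensor_eval_singleton conv_def[abs_def])
  finally show "conv (conv \<phi> \<psi>) \<tau> x = conv \<phi> (conv \<psi> \<tau>) x" .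
qed

lemma linear_counit_unit: "linear (\<lambda>a. \<epsilon> a *\<^sub>R tens [])"
  by (rule linearI) (simp_all add: linear_add[OF linear_counit] linear_scale[OF linear_counit] scaleR_add_left)

lemma counit_unit_in: "\<epsilon> a *\<^sub>R tens [] \<in> tensor_power TYPE('a) 0"
  unfolding tensor_power_def by (intro span_scale span_base) auto

lemma tensor_eval_Nil: "tensor_eval [] (c *\<^sub>R tens []) = c"
  by (simp add: linear_scale[OF linear_tensor_eval] tensor_eval_tens)

text \<open>The left counit axiom, read through \<open>[] @ [\<phi>]\<close>: the values
  \<open>\<epsilon> a *\<^sub>R tens []\<close> lie in the zeroth tensor power, where the empty list
  of functionals recovers the scalar.\<close>

lemma conv_counit_left: "linear \<phi> \<Longrightarrow> conv \<epsilon> \<phi> = \<phi>"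
proof
  fix x assume "linear \<phi>"
  then have "conv \<epsilon> \<phi> x = tensor_eval ([] @ [\<phi>]) (tensor_map (\<lambda>a. \<epsilon> a *\<^sub>R tens []) tens1 (\<Delta> x))"
    by (subst tensor_eval_map) (simp_all add: linear_counit_unit linear_tens1 counit_unit_in
        tensor_eval_singleton tensor_eval_Nil conv_def)
  then show "conv \<epsilon> \<phi> x = \<phi> x" using \<open>linear \<phi>\<close> by (simp add: counit_left tensor_eval_singleton)
qed

lemma conv_counit_right: "linear \<phi> \<Longrightarrow> conv \<phi> \<epsilon> = \<phi>"
proof
  fix x assume "linear \<phi>"
  then have "conv \<phi> \<epsilon> x = tensor_eval ([\<phi>] @ []) (tensor_map tens1 (\<lambda>a. \<epsilon> a *\<^sub>R tens []) (\<Delta> x))"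
    by (subst tensor_eval_map) (simp_all add: linear_counit_unit linear_tens1 tens_in_tensor_power
        tensor_eval_singleton tensor_eval_Nil conv_def)
  then show "conv \<phi> \<epsilon> x = \<phi> x" using \<open>linear \<phi>\<close> by (simp add: counit_right tensor_eval_singleton)
qed

lemma linear_iterated_coproduct: "linear (iterated_coproduct \<Delta> \<epsilon> l)"
proof (induction l rule: induct_nat_012)
  case 0
  then show ?case by (simp add: linear_counit_unit)
next
  case 1
  then show ?case by (simp add: linear_tens1)
next
  case (ge2 l)
  then show ?case
    by (simp add: linear_compose'[OF linear_coproduct linear_tensor_map[OF linear_tens1 ge2(2)]])
qed

text \<open>The recursion of \<open>iterated_coproduct\<close> is nested to the right like the fold,
  so the two unfold in parallel. At length one the fold carries an extra \<open>\<epsilon>\<close>,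
  which the right counit axiom removes.\<close>

lemma tensor_eval_iterated_coproduct:
  "\<forall>\<phi>\<in>set \<phi>s. linear \<phi> \<Longrightarrow>
    tensor_eval \<phi>s (iterated_coproduct \<Delta> \<epsilon> (length \<phi>s) x) = foldr conv \<phi>s \<epsilon> x"
proof (induction \<phi>s arbitrary: x rule: induct_list012)
  case 1
  then show ?case by (simp add: tensor_eval_Nil)
next
  case (2 \<phi>)
  then show ?case by (simp add: conv_counit_right tensor_eval_singleton)
next
  case (3 \<phi> \<psi> \<phi>s)
  let ?G = "iterated_coproduct \<Delta> \<epsilon> (Suc (length \<phi>s))"
  have "tensor_eval ([\<phi>] @ \<psi> # \<phi>s) (tensor_map tens1 ?G (\<Delta> x)) =
    tensor_eval [\<lambda>a. tensor_eval [\<phi>] (tens1 a), \<lambda>b. tensor_eval (\<psi> # \<phi>s) (?G b)] (\<Delta> x)"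
    by (rule tensor_eval_map) (use 3(3) in \<open>auto simp: linear_tens1 linear_iterated_coproduct
        tens_in_tensor_power\<close>)
  moreover have "(\<lambda>b. tensor_eval (\<psi> # \<phi>s) (?G b)) = foldr conv (\<psi> # \<phi>s) \<epsilon>"
    using 3(2) 3(3) by (intro ext) simp
  ultimately show ?case using 3(3) by (simp add: tensor_eval_singleton conv_def[of \<phi>])
qed

section \<open>Convolution powers and their binomial formula\<close>

definition conv_power :: "('a \<Rightarrow> real) \<Rightarrow> nat \<Rightarrow> 'a \<Rightarrow> real" where
  "conv_power \<phi> n = foldr conv (replicate n \<phi>) \<epsilon>"

lemma conv_power_0 [simp]: "conv_power \<phi> 0 = \<epsilon>"
  and conv_power_Suc [simp]: "conv_power \<phi> (Suc n) = conv \<phi> (conv_power \<phi> n)"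
  by (simp_all add: conv_power_def)

lemma linear_conv_power: "linear \<phi> \<Longrightarrow> linear (conv_power \<phi> n)"
  unfolding conv_power_def by (rule linear_convs) simp

lemma conv_power_add:
  "linear \<phi> \<Longrightarrow> conv_power \<phi> (m + n) = conv (conv_power \<phi> m) (conv_power \<phi> n)"
  by (induction m) (simp_all add: conv_counit_left conv_assoc linear_conv_power)

text \<open>In terms of coproducts: splitting by \<open>D\<close> and then each block into single
  letters amounts to splitting into single letters at once. Coassociativity enters through
  \<open>conv_power_add\<close>.\<close>

lemma convs_conv_power:
  "linear \<phi> \<Longrightarrow> foldr conv (map (conv_power \<phi>) D) \<epsilon> = conv_power \<phi> (sum_list D)"
  by (induction D) (simp_all add: conv_power_add)

text \<open>Pulled back along the product, the derivation \<open>\<phi>\<close> becomes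
  \<open>\<phi> \<otimes> \<epsilon> + \<epsilon> \<otimes> \<phi>\<close>, and the coproduct is
  multiplicative. So this is the binomial theorem for two commuting summands, proved by Pascal's
  rule.\<close>

lemma conv_power_derivation_mult:
  assumes \<phi>: "linear \<phi>" and der: "\<And>x y. \<phi> (x * y) = \<phi> x * \<epsilon> y + \<epsilon> x * \<phi> y"
  shows "conv_power \<phi> n (x * y) =
    (\<Sum>k\<le>n. real (n choose k) * (conv_power \<phi> k x * conv_power \<phi> (n - k) y))"
proof (induction n arbitrary: x y)
  case 0
  show ?case by (simp add: counit_mult)
next
  case (Suc n)
  let ?p = "conv_power \<phi>"
  define F where "F k = ?p k x * ?p (Suc n - k) y" for k
  have "?p (Suc n) (x * y) = tensor_eval [\<phi>, ?p n] (tensor_times (\<Delta> x) (\<Delta> y))"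
    by (simp add: conv_def coproduct_mult)
  \<comment> \<open>The boolean \<open>b\<close> records whether \<open>\<phi>\<close> falls on
    \<open>x\<close> or on \<open>y\<close>; the other argument receives
    \<open>\<epsilon>\<close>.\<close>
  also have "\<dots> = (\<Sum>b\<in>UNIV. \<Sum>k\<le>n. real (n choose k) *
      (tensor_eval [if b then \<phi> else \<epsilon>, ?p k] (\<Delta> x) * tensor_eval [if b then \<epsilon> else \<phi>, ?p (n - k)] (\<Delta> y)))"
    by (rule tensor_eval_times) (simp_all add: \<phi> linear_counit linear_conv_power UNIV_bool der Suc)
  also have "\<dots> = (\<Sum>k\<le>n. real (n choose k) * (conv \<epsilon> (?p k) x * conv \<phi> (?p (n - k)) y))
      + (\<Sum>k\<le>n. real (n choose k) * (conv \<phi> (?p k) x * conv \<epsilon> (?p (n - k)) y))"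
    by (simp add: UNIV_bool conv_def)
  also have "\<dots> = (\<Sum>k\<le>n. real (n choose k) * F k) + (\<Sum>k\<le>n. real (n choose k) * F (Suc k))"
    by (intro arg_cong2[of _ _ _ _ "(+)"] sum.cong)
      (simp_all add: F_def conv_counit_left linear_conv_power \<phi> Suc_diff_le)
  \<comment> \<open>The added term vanishes because \<open>n choose Suc n\<close> is zero. After the
    index shift the two sums combine by Pascal's rule.\<close>
  also have "(\<Sum>k\<le>n. real (n choose k) * F k) = (\<Sum>k\<le>Suc n. real (n choose k) * F k)"
    by simp
  also have "\<dots> = F 0 + (\<Sum>k\<le>n. real (n choose Suc k) * F (Suc k))"
    by (subst sum.atMost_Suc_shift) simp
  also have "\<dots> + (\<Sum>k\<le>n. real (n choose k) * F (Suc k)) =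
      F 0 + (\<Sum>k\<le>n. real (Suc n choose Suc k) * F (Suc k))"
    by (simp add: algebra_simps sum.distrib)
  also have "\<dots> = (\<Sum>k\<le>Suc n. real (Suc n choose k) * F k)"
    by (subst sum.atMost_Suc_shift) simp
  finally show ?case by (simp only: F_def)
qed

end

section \<open>Graded bases\<close>

lemma component_eqI:
  assumes "graded_by H" "finite {n. c n \<noteq> 0}" "\<And>n. c n \<in> H n" "x = (\<Sum>n | c n \<noteq> 0. c n)"
  shows "component H n x = c n"
proof -
  have "(THE c. finite {n. c n \<noteq> 0} \<and> (\<forall>n. c n \<in> H n) \<and> x = (\<Sum>n | c n \<noteq> 0. c n)) = c"
    by (rule the1_equality) (use assms in \<open>auto simp: graded_by_def\<close>)
  then show ?thesis by (simp add: component_def)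
qed

lemma
  assumes "graded_by H"
  shows finite_component: "finite {n. component H n x \<noteq> 0}"
    and component_in: "component H n x \<in> H n"
    and sum_components: "(\<Sum>n | component H n x \<noteq> 0. component H n x) = x"
proof -
  obtain c where c: "finite {n. c n \<noteq> 0}" "\<And>n. c n \<in> H n" "x = (\<Sum>n | c n \<noteq> 0. c n)"
    using assms unfolding graded_by_def by metis
  have "(\<lambda>n. component H n x) = c"
    using component_eqI[OF assms c] by auto
  then have "component H n x = c n" for n by (rule fun_cong)
  then show "finite {n. component H n x \<noteq> 0}" "component H n x \<in> H n"
    "(\<Sum>n | component H n x \<noteq> 0. component H n x) = x" using c by simp_all
qed

text \<open>Sums and multiples of decompositions are again decompositions, and decompositions are
  unique. The set \<open>A\<close> below is a common finite support for the two summands.\<close>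

lemma linear_component:
  assumes "graded_by H"
  shows "linear (component H n)"
proof -
  have sub: "subspace (H n)" for n using assms by (simp add: graded_by_def)
  note f = finite_component[OF assms] and i = component_in[OF assms] and s = sum_components[OF assms]
  have s': "(\<Sum>n\<in>A. component H n x) = x" if "finite A" "{n. component H n x \<noteq> 0} \<subseteq> A" for A x
  proof -
    have "(\<Sum>n\<in>A. component H n x) = (\<Sum>n | component H n x \<noteq> 0. component H n x)"
      by (rule sum.mono_neutral_right) (use that in auto)
    then show ?thesis by (simp only: s)
  qed
  show ?thesis
  proof (rule linearI)
    fix x y :: 'a and r :: real
    define A where "A = {n. component H n x \<noteq> 0} \<union> {n. component H n y \<noteq> 0}"
    have A: "finite A" by (simp add: A_def f)
    show "component H n (x + y) = component H n x + component H n y"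
    proof (rule component_eqI[OF assms])
      show fin: "finite {n. component H n x + component H n y \<noteq> 0}"
        by (rule finite_subset[OF _ A]) (auto simp: A_def)
      show "component H n x + component H n y \<in> H n" for n by (simp add: i sub subspace_add)
      have "x + y = (\<Sum>n\<in>A. component H n x + component H n y)"
        unfolding sum.distrib by (subst (1 2) s'[OF A]) (auto simp: A_def)
      also have "\<dots> = (\<Sum>n | component H n x + component H n y \<noteq> 0. component H n x + component H n y)"
        using A by (intro sum.mono_neutral_right) (auto simp: A_def)
      finally show "x + y = \<dots>" .
    qed
    show "component H n (r *\<^sub>R x) = r *\<^sub>R component H n x"
    proof (rule component_eqI[OF assms])
      show "finite {n. r *\<^sub>R component H n x \<noteq> 0}"
        by (rule finite_subset[OF _ f[of x]]) auto
      show "r *\<^sub>R component H n x \<in> H n" for n by (simp add: i sub subspace_scale)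
      have "r *\<^sub>R x = (\<Sum>n | component H n x \<noteq> 0. r *\<^sub>R component H n x)"
        using s[of x] by (metis scaleR_sum_right)
      also have "\<dots> = (\<Sum>n | r *\<^sub>R component H n x \<noteq> 0. r *\<^sub>R component H n x)"
        using f[of x] by (intro sum.mono_neutral_right) auto
      finally show "r *\<^sub>R x = \<dots>" .
    qed
  qed
qed

lemma component_homogeneous:
  assumes "graded_by H" "x \<in> H m"
  shows "component H n x = (if n = m then x else 0)"
proof (rule component_eqI[OF assms(1)])
  have sub: "subspace (H n)" for n using assms by (simp add: graded_by_def)
  have supp: "{n. (if n = m then x else 0) \<noteq> 0} = (if x = 0 then {} else {m})" by auto
  show "finite {n. (if n = m then x else 0) \<noteq> 0}" unfolding supp by simp
  show "(if n = m then x else 0) \<in> H n" for n using assms sub subspace_0 by auto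
  show "x = (\<Sum>n | (if n = m then x else 0) \<noteq> 0. if n = m then x else 0)" unfolding supp by simp
qed

section \<open>Coordinates in a homogeneous basis\<close>

locale graded_vector_basis =
  fixes H :: "nat \<Rightarrow> 'a::real_vector set" and B :: "nat \<Rightarrow> 'a set"
  assumes graded_by: "graded_by H" and basis: "graded_basis H B"
begin

lemma finite_B: "finite (B n)" and independent_B: "independent (B n)" and span_B: "span (B n) = H n"
  using basis by (auto simp: graded_basis_def)

lemma B_in_H: "b \<in> B n \<Longrightarrow> b \<in> H n"
  using span_B span_base by blast

lemma subspace_H: "subspace (H n)"
  by (metis span_B subspace_span)

lemma B_nonzero: "b \<in> B n \<Longrightarrow> b \<noteq> 0"
  using independent_B dependent_zero by blast

lemma H_disjoint: "x \<in> H m \<Longrightarrow> x \<in> H n \<Longrightarrow> x \<noteq> 0 \<Longrightarrow> m = n"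
  using component_homogeneous[OF graded_by, of x m m] component_homogeneous[OF graded_by, of x n m]
  by (auto split: if_splits)

lemma B_disjoint: "b \<in> B m \<Longrightarrow> b \<in> H n \<Longrightarrow> m = n"
  using H_disjoint B_in_H B_nonzero by blast

text \<open>Projecting a vanishing combination to degree \<open>n\<close> leaves a vanishing
  combination of elements of \<open>B n\<close>; every coefficient is reached by some
  \<open>n\<close>.\<close>

lemma independent_basis_union: "independent (basis_union B)"
  unfolding independent_explicit_finite_subsets
proof (intro allI ballI impI)
  fix A u b
  assume A: "A \<subseteq> basis_union B" "finite A" and u: "(\<Sum>v\<in>A. u v *\<^sub>R v) = 0" and b: "b \<in> A"
  note lin = linear_component[OF graded_by]
  obtain n where n: "b \<in> B n" using A b by auto
  have "0 = component H n (\<Sum>v\<in>A. u v *\<^sub>R v)" by (simp add: u linear_0[OF lin])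
  also have "\<dots> = (\<Sum>v\<in>A. u v *\<^sub>R component H n v)" by (simp add: linear_sum[OF lin] linear_scale[OF lin])
  also have "\<dots> = (\<Sum>v\<in>A. if v \<in> B n then u v *\<^sub>R v else 0)"
  proof (intro sum.cong refl)
    fix v assume "v \<in> A"
    then obtain m where "v \<in> B m" using A by auto
    then show "u v *\<^sub>R component H n v = (if v \<in> B n then u v *\<^sub>R v else 0)"
      using component_homogeneous[OF graded_by B_in_H, of v m n] B_disjoint[of v m n] B_in_H[of v n]
      by (cases "n = m") auto
  qed
  also have "\<dots> = (\<Sum>v\<in>A \<inter> B n. u v *\<^sub>R v)" using A by (simp add: sum.inter_restrict)
  finally have "(\<Sum>v\<in>A \<inter> B n. u v *\<^sub>R v) = 0" by simp
  then show "u b = 0"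
    using independent_B[of n, unfolded independent_explicit_finite_subsets] A n b by blast
qed

lemma span_basis_union: "span (basis_union B) = UNIV"
proof -
  have "x \<in> span (basis_union B)" for x
  proof -
    have "component H n x \<in> span (basis_union B)" for n
      using component_in[OF graded_by, of n x] span_mono[of "B n" "basis_union B"] span_B by auto
    then have "(\<Sum>n | component H n x \<noteq> 0. component H n x) \<in> span (basis_union B)"
      by (intro span_sum) auto
    then show ?thesis by (simp add: sum_components[OF graded_by])
  qed
  then show ?thesis by auto
qed

abbreviation coord :: "'a \<Rightarrow> 'a \<Rightarrow> real" where
  "coord \<equiv> representation (basis_union B)"

lemma linear_coord: "linear (\<lambda>x. coord x b)"
  by (rule linearI) (simp_all add: representation_add[OF independent_basis_union]
      representation_scale[OF independent_basis_union] span_basis_union)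

lemma coord_basis: "b \<in> B n \<Longrightarrow> coord b c = (if b = c then 1 else 0)"
  by (subst representation_basis[OF independent_basis_union]) auto

lemma coord_outside: "x \<in> H m \<Longrightarrow> b \<in> B n \<Longrightarrow> m \<noteq> n \<Longrightarrow> coord x b = 0"
proof -
  assume x: "x \<in> H m" and b: "b \<in> B n" "m \<noteq> n"
  have "coord c b = 0" if "c \<in> B m" for c
    using B_disjoint[OF b(1), of m] b(2) B_in_H[OF that] coord_basis[OF that] by auto
  then show ?thesis using linear_eq_0_on_span[OF linear_coord, of "B m"] x span_B by auto
qed

lemma coord_expansion:
  assumes "x \<in> H n"
  shows "x = (\<Sum>b\<in>B n. coord x b *\<^sub>R b)"
proof -
  have "(\<Sum>b\<in>B n. representation (B n) x b *\<^sub>R b) = x"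
    by (rule sum_representation_eq) (use assms independent_B span_B finite_B in auto)
  moreover have "coord x = representation (B n) x"
    by (rule representation_extend) (use independent_basis_union assms span_B in auto)
  ultimately show ?thesis by simp
qed

lemma linear_eq_on_basis:
  assumes "linear f" "linear g" "\<And>n b. b \<in> B n \<Longrightarrow> f b = g b"
  shows "f = g"
proof
  fix x show "f x = g x"
    by (rule linear_eq_on[OF assms(1,2), of x "basis_union B"]) (auto simp: span_basis_union assms(3))
qed

lemma linear_eq_on_homogeneous:
  assumes "linear f" "linear g" "\<And>n b. b \<in> H n \<Longrightarrow> f b = g b"
  shows "f = g"
  using linear_eq_on_basis[OF assms(1,2)] assms(3) B_in_H by blast

lemma linear_graded_projection: "linear (graded_projection H D)"
  and graded_projection_tens: "graded_projection H D (tens xs) =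
    (if length xs = length D then tens (map2 (component H) D xs) else 0)"
proof -
  have "multilinear (\<lambda>xs. if length D = length xs then tens (map2 (component H) D xs) else 0)"
    by (rule multilinear_map2[OF linear_component[OF graded_by]])
  then have "multilinear (\<lambda>xs. if length xs = length D then tens (map2 (component H) D xs) else 0)"
    by (simp only: eq_commute[of "length D"])
  then show "linear (graded_projection H D)" "graded_projection H D (tens xs) =
    (if length xs = length D then tens (map2 (component H) D xs) else 0)"
    unfolding graded_projection_def by (simp_all add: linear_tensor_lift tensor_lift_tens)
qed

end

section \<open>The rescaling function as a convolution power\<close>

locale descent_hopf_algebra =
  graded_connected_hopf_algebra H \<Delta> \<epsilon> + graded_vector_basis H B
  for H :: "nat \<Rightarrow> 'a::real_algebra_1 set" and \<Delta> \<epsilon> and B :: "nat \<Rightarrow> 'a set" +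
  assumes conditions: "descent_chain_conditions \<Delta> B"
begin

section \<open>Degrees zero and one\<close>

definition bullet :: 'a where
  "bullet = the_elem (B 1)"

lemma B_1: "B 1 = {bullet}"
proof -
  have "card (B 1) = 1" using conditions by (simp add: descent_chain_conditions_def)
  then obtain b where "B 1 = {b}" by (rule card_1_singletonE)
  then show ?thesis by (simp add: bullet_def)
qed

lemma bullet_in: "bullet \<in> B 1"
  unfolding B_1 by simp

lemma coord_mult_nonneg:
  "w \<in> basis_union B \<Longrightarrow> z \<in> basis_union B \<Longrightarrow> y \<in> basis_union B \<Longrightarrow> coord (w * z) y \<ge> 0"
  using conditions unfolding descent_chain_conditions_def by blast

lemma H_0D: "x \<in> H 0 \<Longrightarrow> \<exists>c. x = c *\<^sub>R 1"
  by (auto simp: connected span_singleton)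

lemma one_in_H_0: "1 \<in> H 0"
  by (simp add: connected span_base)

text \<open>\<open>B 0\<close> is only known to be a basis of the line spanned by \<open>1\<close>, so its element is a multiple of \<open>1\<close>; condition (i)
  makes the factor positive.\<close>

lemma B_0D:
  assumes "e \<in> B 0"
  obtains c where "c > 0" "e = c *\<^sub>R 1"
proof -
  obtain c where c: "e = c *\<^sub>R 1" using H_0D B_in_H assms by blast
  have "coord (e * e) e = c * coord e e"
    using c linear_scale[OF linear_coord, of c e e] by simp
  then have "c \<ge> 0" using coord_mult_nonneg[of e e e] assms by (auto simp: coord_basis)
  moreover have "c \<noteq> 0" using B_nonzero[OF assms] c by auto
  ultimately show ?thesis using c that by auto
qed

definition bullet_coord :: "'a \<Rightarrow> real" where
  "bullet_coord x = coord x bullet"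

lemma linear_bullet_coord: "linear bullet_coord"
  unfolding bullet_coord_def[abs_def] by (rule linear_coord)

lemma bullet_coord_outside: "x \<in> H n \<Longrightarrow> n \<noteq> 1 \<Longrightarrow> bullet_coord x = 0"
  unfolding bullet_coord_def by (rule coord_outside[OF _ bullet_in])

lemma bullet_coord_bullet: "bullet_coord bullet = 1"
  unfolding bullet_coord_def using coord_basis[OF bullet_in] by simp

text \<open>Degree one is the line through \<open>bullet\<close>, so a single coordinate determines
  the projection to it.\<close>

lemma component_1: "component H 1 x = bullet_coord x *\<^sub>R bullet"
proof -
  have "component H 1 = (\<lambda>x. bullet_coord x *\<^sub>R bullet)"
  proof (rule linear_eq_on_basis[OF linear_component[OF graded_by]])
    show "linear (\<lambda>x. bullet_coord x *\<^sub>R bullet)"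
      using linear_bullet_coord by (auto simp: linear_iff algebra_simps)
    fix n b assume b: "b \<in> B n"
    show "component H 1 b = bullet_coord b *\<^sub>R bullet"
    proof (cases "n = 1")
      case True
      then have "b = bullet" using b B_1 by auto
      then show ?thesis
        by (simp add: component_homogeneous[OF graded_by B_in_H[OF bullet_in]] bullet_coord_bullet)
    next
      case False
      then show ?thesis
        by (simp add: component_homogeneous[OF graded_by B_in_H[OF b]] bullet_coord_outside[OF B_in_H[OF b]])
    qed
  qed
  then show ?thesis by simp
qed

text \<open>A product of homogeneous elements has degree one only if one factor has degree zero,
  hence is a scalar; if both degrees are positive, both sides vanish. The identity then extends
  linearly, one argument at a time.\<close>

lemma bullet_coord_derivation: "bullet_coord (x * y) = bullet_coord x * \<epsilon> y + \<epsilon> x * bullet_coord y"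
proof -
  note add = linear_add[OF linear_bullet_coord] linear_add[OF linear_counit]
  note scale = linear_scale[OF linear_bullet_coord] linear_scale[OF linear_counit]
  have hom: "bullet_coord (x * y) = bullet_coord x * \<epsilon> y + \<epsilon> x * bullet_coord y"
    if x: "x \<in> H i" and y: "y \<in> H j" for i j x y
  proof -
    consider "i = 0" | "i > 0" "j = 0" | "i > 0" "j > 0" by blast
    then show ?thesis
    proof cases
      case 1
      then obtain c where "x = c *\<^sub>R 1" using H_0D x by blast
      then show ?thesis using 1 bullet_coord_outside[of 1 0] one_in_H_0 by (simp add: scale counit_one)
    next
      case 2
      then obtain c where "y = c *\<^sub>R 1" using H_0D y by blast
      then show ?thesis using 2 bullet_coord_outside[of 1 0] one_in_H_0 by (simp add: scale counit_one)
    next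
      case 3
      then show ?thesis using graded_counit[OF _ x] graded_counit[OF _ y]
          bullet_coord_outside[OF graded_mult[OF x y]] by simp
    qed
  qed
  have hom_left: "(\<lambda>y. bullet_coord (x * y)) = (\<lambda>y. bullet_coord x * \<epsilon> y + \<epsilon> x * bullet_coord y)"
    if "x \<in> H i" for i x
    by (rule linear_eq_on_homogeneous)
      (auto intro!: linearI simp: add scale hom[OF that] algebra_simps)
  have hom': "bullet_coord (x * y) = bullet_coord x * \<epsilon> y + \<epsilon> x * bullet_coord y"
    if "x \<in> H i" for i x
    using fun_cong[OF hom_left[OF that]] .
  have "(\<lambda>x. bullet_coord (x * y)) = (\<lambda>x. bullet_coord x * \<epsilon> y + \<epsilon> x * bullet_coord y)"
    by (rule linear_eq_on_homogeneous)
      (auto intro!: linearI simp: add scale hom' algebra_simps)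
  then show ?thesis by (rule fun_cong)
qed

section \<open>The rescaling function on products\<close>

abbreviation eta :: "nat \<Rightarrow> 'a \<Rightarrow> real" where
  "eta \<equiv> conv_power bullet_coord"

lemma linear_eta: "linear (eta n)"
  by (rule linear_conv_power[OF linear_bullet_coord])

lemma eta_1: "eta (Suc 0) = bullet_coord"
  by (simp add: conv_counit_right linear_bullet_coord)

text \<open>Each convolution factor \<open>bullet_coord\<close> consumes exactly one degree, and the
  final \<open>\<epsilon>\<close> accepts only degree zero.\<close>

lemma eta_outside: "x \<in> H k \<Longrightarrow> k \<noteq> n \<Longrightarrow> eta n x = 0"
proof (induction n arbitrary: k x)
  case 0
  then show ?case by (simp add: graded_counit)
next
  case (Suc n)
  have "tensor_eval [bullet_coord, eta n] t = 0"
    if t: "t \<in> {tens [a, b] | a b i j. i + j = k \<and> a \<in> H i \<and> b \<in> H j}" for t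
  proof -
    obtain a b i j where ab: "t = tens [a, b]" "i + j = k" "a \<in> H i" "b \<in> H j" using t by auto
    have "i \<noteq> 1 \<or> j \<noteq> n" using ab(2) Suc.prems(2) by auto
    then show ?thesis
      using bullet_coord_outside[OF ab(3)] Suc.IH[OF ab(4)] ab(1)
      by (auto simp: tensor_eval_pair linear_bullet_coord linear_eta)
  qed
  then have "tensor_eval [bullet_coord, eta n] (\<Delta> x) = 0"
    using linear_eq_0_on_span[OF linear_tensor_eval _ graded_coproduct[OF Suc.prems(1)]]
    by (simp add: linear_bullet_coord linear_eta)
  then show ?case by (simp add: conv_def)
qed

text \<open>Of the binomial expansion only the term \<open>k = i\<close> survives, since
  \<open>eta k\<close> vanishes on degree \<open>i\<close> for all other \<open>k\<close>.\<close>

lemma eta_mult_homogeneous: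
  assumes "x \<in> H i" "y \<in> H j"
  shows "eta (i + j) (x * y) = real ((i + j) choose i) * (eta i x * eta j y)"
proof -
  have "eta (i + j) (x * y) = (\<Sum>k\<le>i + j. real ((i + j) choose k) * (eta k x * eta (i + j - k) y))"
    by (rule conv_power_derivation_mult[OF linear_bullet_coord bullet_coord_derivation])
  also have "\<dots> = (\<Sum>k\<in>{i}. real ((i + j) choose k) * (eta k x * eta (i + j - k) y))"
    using eta_outside[OF assms(1)] by (intro sum.mono_neutral_right) auto
  finally show ?thesis by simp
qed

lemma eta_component: "eta d (component H d x) = eta d x"
proof -
  have "(\<lambda>x. eta d (component H d x)) = eta d"
    by (rule linear_eq_on_homogeneous)
      (auto intro!: linear_compose'[OF linear_component[OF graded_by] linear_eta] linear_eta
        simp: component_homogeneous[OF graded_by] eta_outside linear_0[OF linear_eta])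
  then show ?thesis by (rule fun_cong)
qed

lemma multinomial_Cons: "multinomial (d # D) = real ((d + sum_list D) choose d) * multinomial D"
  by (simp add: multinomial_def binomial_fact)

lemma multinomial_pos: "multinomial D > 0"
proof -
  have "prod_list (map fact D) > (0 :: real)" by (induction D) auto
  then show ?thesis by (simp add: multinomial_def)
qed

lemma prod_list_components_in:
  "length xs = length D \<Longrightarrow> prod_list (map2 (component H) D xs) \<in> H (sum_list D)"
  by (induction xs D rule: list_induct2)
    (auto simp: one_in_H_0 intro: graded_mult component_in[OF graded_by])

text \<open>Peeling off one factor at a time produces binomial coefficients, whose product is the
  multinomial coefficient.\<close>

lemma eta_prod_list_components:
  "length xs = length D \<Longrightarrow> eta (sum_list D) (prod_list (map2 (component H) D xs)) =
    multinomial D * prod_list (map2 (\<lambda>\<phi> x. \<phi> x) (map eta D) xs)"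
proof (induction xs D rule: list_induct2)
  case Nil
  then show ?case by (simp add: multinomial_def counit_one)
next
  case (Cons x xs d D)
  then show ?case
    by (simp add: eta_mult_homogeneous[OF component_in[OF graded_by] prod_list_components_in[OF Cons(1)]]
        eta_component multinomial_Cons)
qed

section \<open>Descent operators and the eigenvalue equation for the rescaling function\<close>

abbreviation descent :: "nat list \<Rightarrow> 'a \<Rightarrow> 'a" where
  "descent D x \<equiv> tensor_prod (coproduct_comp H \<Delta> \<epsilon> D x)"

lemma linear_coproduct_comp: "linear (coproduct_comp H \<Delta> \<epsilon> D)"
  unfolding coproduct_comp_def[abs_def]
  by (rule linear_compose'[OF linear_iterated_coproduct linear_graded_projection])

lemma linear_descent: "linear (descent D)"
  by (rule linear_compose'[OF linear_coproduct_comp linear_tensor_prod])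

text \<open>Multiplying the projected tensor and applying \<open>eta\<close> amounts, up to the
  multinomial factor, to evaluating with \<open>map eta D\<close>. On the iterated coproduct that
  evaluation is a convolution of powers, which merge into one.\<close>

lemma eta_descent: "eta (sum_list D) (descent D x) = multinomial D * eta (sum_list D) x"
proof -
  have lin: "\<forall>\<phi>\<in>set (map eta D). linear \<phi>" using linear_eta by auto
  have "eta (sum_list D) (tensor_prod (graded_projection H D t)) = multinomial D * tensor_eval (map eta D) t"
    for t
  proof (rule tensor_eqI[of _ _ t])
    show "linear (\<lambda>t. eta (sum_list D) (tensor_prod (graded_projection H D t)))"
      by (rule linear_compose'[OF linear_compose'[OF linear_graded_projection linear_tensor_prod] linear_eta])
    show "linear (\<lambda>t. multinomial D * tensor_eval (map eta D) t)"
      using linear_compose_scale_right[OF linear_tensor_eval[OF lin]] by simp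
  qed (auto simp: graded_projection_tens tensor_prod_tens tensor_eval_tens[OF lin] eta_prod_list_components
      linear_0[OF linear_eta] linear_0[OF linear_tensor_prod])
  then show ?thesis
    using tensor_eval_iterated_coproduct[OF lin, of x]
    by (simp add: coproduct_comp_def convs_conv_power linear_bullet_coord)
qed

lemma descent_in: "descent D x \<in> H (sum_list D)"
proof -
  have "tensor_prod (graded_projection H D t) \<in> H (sum_list D)" for t
  proof -
    have "t \<in> span (range tens)" by (simp add: span_tens)
    then show ?thesis
    proof (induction rule: span_induct_alt)
      case base
      then show ?case
        by (simp add: linear_0[OF linear_graded_projection] linear_0[OF linear_tensor_prod] subspace_0 subspace_H)
    next
      case (step c s t)
      then show ?case
        by (auto simp: linear_add[OF linear_graded_projection] linear_add[OF linear_tensor_prod]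
            linear_scale[OF linear_graded_projection] linear_scale[OF linear_tensor_prod]
            linear_0[OF linear_tensor_prod] graded_projection_tens tensor_prod_tens
            intro!: subspace_0[OF subspace_H] subspace_add[OF subspace_H] subspace_scale[OF subspace_H] prod_list_components_in)
    qed
  qed
  then show ?thesis by (simp add: coproduct_comp_def)
qed

text \<open>Projecting every letter to degree one replaces it by a multiple of
  \<open>bullet\<close>. The collected scalar is the evaluation with \<open>n\<close> copies of
  \<open>bullet_coord\<close>, that is, the \<open>n\<close>-th convolution power.\<close>

lemma rescaling_eq_eta: "rescaling H \<Delta> \<epsilon> B n x = eta n x"
proof -
  let ?b = "tens (replicate n bullet)" and ?\<phi>s = "replicate n bullet_coord"
  have lin: "\<forall>\<phi>\<in>set ?\<phi>s. linear \<phi>" using linear_bullet_coord by auto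
  have map2: "map2 (component H) (replicate (length xs) 1) xs =
      map2 (\<lambda>c x. c *\<^sub>R x) (map2 (\<lambda>\<phi> x. \<phi> x) (replicate (length xs) bullet_coord) xs) (replicate (length xs) bullet)"
    for xs by (induction xs) (simp_all add: component_1[unfolded One_nat_def])
  have "graded_projection H (replicate n 1) t = tensor_eval ?\<phi>s t *\<^sub>R ?b" for t
  proof (rule tensor_eqI[of _ _ t])
    show "linear (\<lambda>t. tensor_eval ?\<phi>s t *\<^sub>R ?b)"
      using linear_tensor_eval[OF lin] by (auto simp: linear_iff scaleR_add_left)
    fix xs
    show "graded_projection H (replicate n 1) (tens xs) = tensor_eval ?\<phi>s (tens xs) *\<^sub>R ?b"
    proof (cases "length xs = n")
      case True
      then show ?thesis
        by (auto simp only: graded_projection_tens tensor_eval_tens[OF lin] map2 length_replicate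
            tens_map_scale length_map length_zip min.idem if_True simp_thms)
    qed (auto simp: graded_projection_tens tensor_eval_tens[OF lin])
  qed (rule linear_graded_projection)
  then have *: "coproduct_comp H \<Delta> \<epsilon> (replicate n 1) x = eta n x *\<^sub>R ?b"
    using tensor_eval_iterated_coproduct[OF lin, of x] by (simp add: coproduct_comp_def conv_power_def)
  have sub: "{tens xs | xs. length xs = n \<and> set xs \<subseteq> basis_union B} \<subseteq> {tens xs | xs. set xs \<subseteq> basis_union B}"
    by auto
  note indep = independent_mono[OF independent_tens(1)[OF independent_basis_union] sub]
  have mem: "?b \<in> {tens xs | xs. length xs = n \<and> set xs \<subseteq> basis_union B}"
    using bullet_in by (auto intro!: exI[of _ "replicate n bullet"])
  show ?thesis
    unfolding rescaling_def * bullet_def[symmetric]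
    using representation_scale[OF indep span_base[OF mem]] representation_basis[OF indep mem] by simp
qed

end

section \<open>Positivity\<close>

context descent_hopf_algebra
begin

lemma bullet_coord_nonneg: "b \<in> B n \<Longrightarrow> bullet_coord b \<ge> 0"
  by (simp add: bullet_coord_def coord_basis)

lemma counit_nonneg: "b \<in> B n \<Longrightarrow> \<epsilon> b \<ge> 0"
proof (cases "n = 0")
  assume b: "b \<in> B n" "n = 0"
  then obtain c where "c > 0" "b = c *\<^sub>R 1" using B_0D by blast
  then show ?thesis by (simp add: linear_scale[OF linear_counit] counit_one)
qed (simp add: graded_counit B_in_H)

text \<open>Condition (ii) gives signs with respect to all pure basis tensors, and the grading of
  the coproduct restricts them to total degree \<open>n\<close>. Coefficients with respect to the
  smaller family agree because the larger one is independent.\<close>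

lemma coproduct_nonneg_span:
  assumes x: "x \<in> B n"
  shows "\<Delta> x \<in> nonneg_span {tens [w, z] | w z i j. i + j = n \<and> w \<in> B i \<and> z \<in> B j}"
    (is "_ \<in> nonneg_span ?S")
proof (rule nonneg_span_if_representation_nonneg)
  let ?T = "{tens [u, v] | u v. u \<in> basis_union B \<and> v \<in> basis_union B}"
  have ST: "?S \<subseteq> ?T" by blast
  have "?T \<subseteq> {tens xs | xs. set xs \<subseteq> basis_union B}"
  proof clarify
    fix u v i j assume "u \<in> B i" "v \<in> B j"
    then show "\<exists>xs. tens [u, v] = tens xs \<and> set xs \<subseteq> basis_union B"
      by (intro exI[of _ "[u, v]"]) auto
  qed
  with independent_tens(1)[OF independent_basis_union] have T: "independent ?T"
    by (rule independent_mono)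
  with ST show "independent ?S" by (rule independent_mono[rotated])
  \<comment> \<open>The letters are expanded one at a time, first \<open>a\<close> in
    \<open>B i\<close> and then \<open>b\<close> in \<open>B j\<close>.\<close>
  have "tens [a, b] \<in> span ?S" if ij: "i + j = n" and a: "a \<in> H i" and b: "b \<in> H j" for a b i j
  proof -
    have "a \<in> span (B i)" "b \<in> span (B j)" using a b span_B by auto
    then have "tens [a, b] \<in> span ((\<lambda>a. tens [a, b]) ` B i)"
      by (simp add: linear_span_image linear_tens2)
    moreover have "tens [w, b] \<in> span ?S" if "w \<in> B i" for w
    proof -
      have "tens [w, b] \<in> span ((\<lambda>b. tens [w, b]) ` B j)"
        using \<open>b \<in> span (B j)\<close> by (simp add: linear_span_image linear_tens2)
      also have "\<dots> \<subseteq> span ?S" using that ij by (intro span_mono) blast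
      finally show ?thesis .
    qed
    ultimately show ?thesis using span_minimal[of "(\<lambda>a. tens [a, b]) ` B i" "span ?S"] by auto
  qed
  then have "span {tens [a, b] | a b i j. i + j = n \<and> a \<in> H i \<and> b \<in> H j} \<subseteq> span ?S"
    by (intro span_minimal) auto
  then show in_span: "\<Delta> x \<in> span ?S" using graded_coproduct[OF B_in_H[OF x]] by blast
  fix s assume "s \<in> ?S"
  then have "s \<in> ?T" using ST by blast
  then obtain w z where s: "s = tens [w, z]" "w \<in> basis_union B" "z \<in> basis_union B" by blast
  have "representation ?T (\<Delta> x) s \<ge> 0"
    using conditions x s unfolding descent_chain_conditions_def by blast
  then show "representation ?S (\<Delta> x) s \<ge> 0"
    unfolding representation_extend[OF T in_span ST] .
qed

lemma eta_nonneg: "b \<in> B k \<Longrightarrow> eta n b \<ge> 0"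
proof (induction n arbitrary: k b)
  case 0
  then show ?case by (simp add: counit_nonneg)
next
  case (Suc n)
  have lin: "linear (tensor_eval [bullet_coord, eta n])"
    by (rule linear_tensor_eval) (simp add: linear_bullet_coord linear_eta)
  show ?case unfolding conv_power_Suc conv_def
    by (rule nonneg_span_linear_nonneg[OF lin coproduct_nonneg_span[OF Suc.prems]])
      (auto simp: tensor_eval_pair linear_bullet_coord linear_eta bullet_coord_nonneg Suc.IH)
qed

text \<open>For \<open>t = \<Delta> x\<close> the second alternative is excluded by condition (iii) and the counit axioms.\<close>

lemma nonneg_span_coproduct_cases:
  assumes "t \<in> nonneg_span {tens [w, z] | w z i j. i + j = n \<and> w \<in> B i \<and> z \<in> B j}"
    (is "_ \<in> nonneg_span ?S")
  shows "(\<exists>a i j w z r. a > 0 \<and> i + j = n \<and> i > 0 \<and> j > 0 \<and> w \<in> B i \<and> z \<in> B j \<and> r \<in> nonneg_span ?S \<and>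
      t = a *\<^sub>R tens [w, z] + r) \<or> (\<exists>u\<in>H n. \<exists>v\<in>H n. t = tens [1, u] + tens [v, 1])"
    (is "?A t \<or> ?B t")
  using assms
proof induction
  case zero
  have "0 = tens [1, 0] + tens [0, 1]"
    by (simp add: linear_0[OF linear_tens2(1)] linear_0[OF linear_tens2(2)])
  then show ?case using subspace_0[OF subspace_H] by blast
next
  case (step a s t)
  from step.hyps(2) obtain w z i j where s: "s = tens [w, z]" "i + j = n" "w \<in> B i" "z \<in> B j" by blast
  from step.IH show ?case
  proof
    assume "?A t"
    then obtain a' i' j' w' z' r where A: "a' > 0" "i' + j' = n" "i' > 0" "j' > 0" "w' \<in> B i'" "z' \<in> B j'"
      "r \<in> nonneg_span ?S" "t = a' *\<^sub>R tens [w', z'] + r" by blast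
    have "a *\<^sub>R s + t = a' *\<^sub>R tens [w', z'] + (a *\<^sub>R s + r)" using A(8) by simp
    moreover have "a *\<^sub>R s + r \<in> nonneg_span ?S" by (rule nonneg_span.step[OF step.hyps(1,2) A(7)])
    ultimately show ?thesis using A(1-6) by blast
  next
    assume "?B t"
    then obtain u v where uv: "u \<in> H n" "v \<in> H n" "t = tens [1, u] + tens [v, 1]" by blast
    consider "a = 0" | "a > 0" "i > 0" "j > 0" | "i = 0" | "j = 0" using step.hyps(1) by fastforce
    then show ?thesis
    proof cases
      case 1
      then show ?thesis using \<open>?B t\<close> by simp
    next
      case 2
      then show ?thesis using s step.hyps(3) by blast
    next
      case 3
      then obtain c where c: "w = c *\<^sub>R 1" using B_0D s(3) by metis
      have "a *\<^sub>R s + t = tens [1, (a * c) *\<^sub>R z + u] + tens [v, 1]"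
        by (simp add: s(1) c uv(3) linear_add[OF linear_tens2(2)] linear_scale[OF linear_tens2(2)]
            linear_scale[OF linear_tens2(1)])
      moreover have "(a * c) *\<^sub>R z + u \<in> H n"
        using 3 s B_in_H uv by (auto intro!: subspace_add subspace_scale subspace_H)
      ultimately show ?thesis using uv by blast
    next
      case 4
      then obtain c where c: "z = c *\<^sub>R 1" using B_0D s(4) by metis
      have "a *\<^sub>R s + t = tens [1, u] + tens [(a * c) *\<^sub>R w + v, 1]"
        by (simp add: s(1) c uv(3) linear_add[OF linear_tens2(1)] linear_scale[OF linear_tens2(2)]
            linear_scale[OF linear_tens2(1)])
      moreover have "(a * c) *\<^sub>R w + v \<in> H n"
        using 4 s B_in_H uv by (auto intro!: subspace_add subspace_scale subspace_H)
      ultimately show ?thesis using uv by blast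
    qed
  qed
qed

text \<open>For \<open>n > 1\<close>, condition (iii) leaves in \<open>\<Delta> x\<close> a term
  \<open>w \<otimes> z\<close> with positive coefficient and both degrees positive, hence both below
  \<open>n\<close>. By induction it contributes positively to \<open>eta i \<otimes> eta j\<close>,
  and the remaining terms cannot cancel it.\<close>

lemma eta_pos: "x \<in> B n \<Longrightarrow> eta n x > 0"
proof (induction n arbitrary: x rule: less_induct)
  case (less n)
  consider "n = 0" | "n = 1" | "n > 1" by linarith
  then show ?case
  proof cases
    case 1
    then obtain c where "c > 0" "x = c *\<^sub>R 1" using B_0D less.prems by blast
    then show ?thesis using 1 by (simp add: linear_scale[OF linear_counit] counit_one)
  next
    case 2
    then have "x = bullet" using less.prems B_1 by auto
    then show ?thesis using 2 by (simp add: eta_1 bullet_coord_bullet del: conv_power_Suc)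
  next
    case 3
    let ?S = "{tens [w, z] | w z i j. i + j = n \<and> w \<in> B i \<and> z \<in> B j}"
    have "\<not> (\<exists>u\<in>H n. \<exists>v\<in>H n. \<Delta> x = tens [1, u] + tens [v, 1])"
    proof clarify
      fix u v assume uv: "u \<in> H n" "v \<in> H n" "\<Delta> x = tens [1, u] + tens [v, 1]"
      \<comment> \<open>The counit kills \<open>u\<close> and \<open>v\<close> as they have positive
        degree; the two counit axioms then force \<open>u = x\<close> and \<open>v = x\<close>, the
        form that (iii) forbids.\<close>
      have "\<epsilon> u = 0" "\<epsilon> v = 0" using 3 uv graded_counit[of n u] graded_counit[of n v] by auto
      then have "tens1 u = tens1 x" "tens1 v = tens1 x"
        using counit_left[of x] counit_right[of x]
        by (simp_all add: uv(3) linear_add[OF linear_tensor_map] linear_counit_unit linear_tens1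
            tensor_map_tens tensor_append_tens counit_one linear_0[OF linear_tensor_append_left]
            linear_0[OF linear_tensor_append_right])
      \<comment> \<open>\<open>tensor_prod\<close> is a left inverse of \<open>tens1\<close>, so
        \<open>tens1\<close> is injective.\<close>
      then have "u = x" "v = x" by (metis tensor_prod_tens prod_list.Cons prod_list.Nil mult_1_right)+
      then show False
        using conditions 3 less.prems uv(3) by (auto simp: descent_chain_conditions_def)
    qed
    then obtain a i j w z r where A: "a > 0" "i + j = n" "i > 0" "j > 0" "w \<in> B i" "z \<in> B j"
      "r \<in> nonneg_span ?S" "\<Delta> x = a *\<^sub>R tens [w, z] + r"
      using nonneg_span_coproduct_cases[OF coproduct_nonneg_span[OF less.prems]] by blast
    have lin: "linear (tensor_eval [eta i, eta j])"
      by (rule linear_tensor_eval) (simp add: linear_eta)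
    have "eta n x = a * (eta i w * eta j z) + tensor_eval [eta i, eta j] r"
      unfolding A(2)[symmetric] conv_power_add[OF linear_bullet_coord] conv_def A(8)
      by (simp add: linear_add[OF lin] linear_scale[OF lin] tensor_eval_pair linear_eta)
    moreover have "tensor_eval [eta i, eta j] r \<ge> 0"
      by (rule nonneg_span_linear_nonneg[OF lin A(7)]) (auto simp: tensor_eval_pair linear_eta eta_nonneg)
    moreover have "eta i w > 0" "eta j z > 0" using A less.IH by auto
    ultimately show ?thesis using A(1) by (simp add: add_pos_nonneg)
  qed
qed

section \<open>Nonnegativity of the coefficients of descent operators\<close>

text \<open>The unit is a positive multiple of a basis element of degree zero, though not
  necessarily one itself. This covers the empty product in the iterated multiplication.\<close>

lemma one_nonneg_span: "1 \<in> nonneg_span (basis_union B)"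
proof -
  have "B 0 \<noteq> {}"
  proof
    assume "B 0 = {}"
    then have "H 0 = {0}" using span_B[of 0] by simp
    then show False using one_in_H_0 by simp
  qed
  then obtain e where e: "e \<in> B 0" by blast
  then obtain c where c: "c > 0" "e = c *\<^sub>R 1" by (rule B_0D)
  then have "1 = (1 / c) *\<^sub>R e" by simp
  also have "\<dots> \<in> nonneg_span (basis_union B)"
    using e c by (intro nonneg_span_scale nonneg_span_base) auto
  finally show ?thesis .
qed

lemma mult_nonneg_span:
  assumes "x \<in> nonneg_span (basis_union B)" "y \<in> nonneg_span (basis_union B)"
  shows "x * y \<in> nonneg_span (basis_union B)"
proof (rule nonneg_span_linear_image[OF _ assms(1), of "\<lambda>x. x * y"])
  show "linear (\<lambda>x. x * y)" by (simp add: linear_iff algebra_simps)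
  fix w assume w: "w \<in> basis_union B"
  show "w * y \<in> nonneg_span (basis_union B)"
  proof (rule nonneg_span_linear_image[OF _ assms(2)])
    show "linear ((*) w)" by (simp add: linear_iff algebra_simps)
    show "w * z \<in> nonneg_span (basis_union B)" if "z \<in> basis_union B" for z
      using w that coord_mult_nonneg
      by (intro nonneg_span_if_representation_nonneg independent_basis_union) (auto simp: span_basis_union)
  qed
qed

lemma iterated_coproduct_nonneg_span:
  "x \<in> basis_union B \<Longrightarrow>
    iterated_coproduct \<Delta> \<epsilon> l x \<in> nonneg_span {tens xs | xs. length xs = l \<and> set xs \<subseteq> basis_union B}"
proof (induction l arbitrary: x rule: induct_nat_012)
  case 0
  then have "\<epsilon> x \<ge> 0" using counit_nonneg by blast
  then show ?case unfolding iterated_coproduct.simps by (intro nonneg_span_scale nonneg_span_base) auto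
next
  case 1
  then have "length [x] = Suc 0 \<and> set [x] \<subseteq> basis_union B" by simp
  then show ?case unfolding One_nat_def iterated_coproduct.simps
    by (intro nonneg_span_base) blast
next
  case (ge2 l)
  let ?G = "iterated_coproduct \<Delta> \<epsilon> (Suc l)"
  obtain n where n: "x \<in> B n" using ge2.prems by blast
  note lin = linear_tens1 linear_iterated_coproduct[of "Suc l"]
  show ?case unfolding iterated_coproduct.simps
  proof (rule nonneg_span_linear_image[OF linear_tensor_map[OF lin] coproduct_nonneg_span[OF n]], clarify)
    fix w z i j assume wz: "w \<in> B i" "z \<in> B j"
    then have "length [w] = 1 \<and> set [w] \<subseteq> basis_union B" by auto
    then have "tens1 w \<in> nonneg_span {tens xs | xs. length xs = 1 \<and> set xs \<subseteq> basis_union B}"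
      by (intro nonneg_span_base) blast
    from nonneg_span_append[OF this ge2(2)[of z]] wz
    show "tensor_map tens1 ?G (tens [w, z])
        \<in> nonneg_span {tens xs | xs. length xs = Suc (Suc l) \<and> set xs \<subseteq> basis_union B}"
      by (auto simp: tensor_map_tens[OF lin])
  qed
qed

text \<open>All three stages preserve the cones: the iterated coproduct by (ii), the projection
  because it keeps or kills each basis letter, and the product by (i).\<close>

lemma coord_descent_nonneg:
  assumes "x \<in> basis_union B" "y \<in> basis_union B"
  shows "coord (descent D x) y \<ge> 0"
proof -
  have prod: "prod_list (map2 (component H) D xs) \<in> nonneg_span (basis_union B)"
    if "length xs = length D" "set xs \<subseteq> basis_union B" for xs
    using that
  proof (induction xs D rule: list_induct2)
    case Nil
    then show ?case by (simp add: one_nonneg_span)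
  next
    case (Cons x xs d D)
    then obtain n where "x \<in> B n" by auto
    then have "component H d x \<in> nonneg_span (basis_union B)"
      by (auto simp: component_homogeneous[OF graded_by B_in_H] intro: nonneg_span_base nonneg_span.zero)
    then show ?case using Cons by (auto intro: mult_nonneg_span)
  qed
  have descent: "descent D x \<in> nonneg_span (basis_union B)"
    unfolding coproduct_comp_def
  proof (rule nonneg_span_linear_image[OF linear_compose'[OF linear_graded_projection linear_tensor_prod]
          iterated_coproduct_nonneg_span[OF assms(1)]], clarify)
    fix xs assume "length xs = length D" "set xs \<subseteq> basis_union B"
    then show "tensor_prod (graded_projection H D (tens xs)) \<in> nonneg_span (basis_union B)"
      by (simp add: graded_projection_tens tensor_prod_tens prod)
  qed
  show ?thesis
    by (rule nonneg_span_linear_nonneg[OF linear_coord descent]) (auto simp: coord_basis)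
qed

end

section \<open>The Doob transform\<close>

lemma has_sum_finite_sum:
  fixes f :: "'i \<Rightarrow> 'a \<Rightarrow> real"
  assumes "\<And>i. i \<in> I \<Longrightarrow> (f i has_sum s i) A"
  shows "((\<lambda>x. \<Sum>i\<in>I. f i x) has_sum (\<Sum>i\<in>I. s i)) A"
  using assms by (induction I rule: infinite_finite_induct) (auto intro: has_sum_add)

lemma pmf_has_sum:
  assumes "set_pmf p \<subseteq> A"
  shows "(pmf p has_sum 1) A"
proof -
  have "pmf p summable_on A"
    using abs_summable_equivalent[of "pmf p" A] pmf_abs_summable[of p A] by simp
  moreover have "infsum (pmf p) A = 1"
    using infsetsum_infsum[OF pmf_abs_summable] infsetsum_pmf_eq_1[OF assms] by metis
  ultimately show ?thesis using has_sum_iff by blast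
qed

context descent_hopf_algebra
begin

text \<open>The matrix \<open>K(x, y)\<close> before the Doob transform, kept as a series over
  \<open>D\<close> so that finite sums over states can be exchanged with the sum over
  \<open>D\<close>.\<close>

definition kernel :: "nat \<Rightarrow> nat list pmf \<Rightarrow> 'a \<Rightarrow> 'a \<Rightarrow> real" where
  "kernel n P x y =
    (\<Sum>\<^sub>\<infinity>D\<in>weak_compositions n. pmf P D / multinomial D * coord (descent D x) y)"

lemma eta_expansion:
  assumes "x \<in> H n"
  shows "(\<Sum>y\<in>B n. coord x y * eta n y) = eta n x"
proof -
  have "eta n x = eta n (\<Sum>y\<in>B n. coord x y *\<^sub>R y)" using coord_expansion[OF assms] by simp
  then show ?thesis by (simp add: linear_sum[OF linear_eta] linear_scale[OF linear_eta])
qed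

lemma sum_coord_descent_eta:
  assumes "D \<in> weak_compositions n"
  shows "(\<Sum>y\<in>B n. coord (descent D x) y * eta n y) = multinomial D * eta n x"
proof -
  have n: "n = sum_list D" using assms by (simp add: weak_compositions_def)
  show ?thesis unfolding n by (simp only: eta_expansion[OF descent_in] eta_descent)
qed

text \<open>Without summability \<open>kernel\<close> would be the junk value \<open>0\<close>. It holds because the identity above, having nonnegative
  terms, bounds each coefficient of \<open>m \<circ> \<Delta>\<^sub>D\<close> by a constant times the multinomial coefficient.\<close>

lemma kernel_has_sum:
  assumes x: "x \<in> B n" and y: "y \<in> B n"
  shows "((\<lambda>D. pmf P D / multinomial D * coord (descent D x) y) has_sum kernel n P x y) (weak_compositions n)"
proof -
  have bound: "pmf P D / multinomial D * coord (descent D x) y \<le> pmf P D * (eta n x / eta n y)"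
    if D: "D \<in> weak_compositions n" for D
  proof -
    have "coord (descent D x) y * eta n y \<le> (\<Sum>y\<in>B n. coord (descent D x) y * eta n y)"
      by (rule member_le_sum[OF y])
        (use x finite_B in \<open>auto intro!: mult_nonneg_nonneg eta_nonneg coord_descent_nonneg\<close>)
    then have "coord (descent D x) y \<le> multinomial D * (eta n x / eta n y)"
      using eta_pos[OF y] unfolding sum_coord_descent_eta[OF D] by (simp add: field_simps)
    then have "pmf P D / multinomial D * coord (descent D x) y
        \<le> pmf P D / multinomial D * (multinomial D * (eta n x / eta n y))"
      using multinomial_pos[of D] by (intro mult_left_mono) simp_all
    then show ?thesis using multinomial_pos[of D] by simp
  qed
  have "pmf P summable_on weak_compositions n"
    using abs_summable_equivalent[of "pmf P"] pmf_abs_summable[of P] by simp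
  then have "(\<lambda>D. pmf P D * (eta n x / eta n y)) summable_on weak_compositions n"
    by (rule summable_on_cmult_left)
  then have "(\<lambda>D. pmf P D / multinomial D * coord (descent D x) y) summable_on weak_compositions n"
  proof (rule summable_on_comparison_test)
    fix D
    show "0 \<le> pmf P D / multinomial D * coord (descent D x) y"
      using x y
      by (intro mult_nonneg_nonneg divide_nonneg_pos multinomial_pos coord_descent_nonneg) auto
  qed (rule bound)
  then show ?thesis unfolding kernel_def by (rule has_sum_infsum)
qed

lemma kernel_nonneg: "x \<in> B n \<Longrightarrow> y \<in> B n \<Longrightarrow> kernel n P x y \<ge> 0"
  unfolding kernel_def
  by (intro infsum_nonneg mult_nonneg_nonneg divide_nonneg_pos multinomial_pos coord_descent_nonneg) auto

text \<open>Invariance of \<open>\<eta>\<close> under \<open>m \<circ> \<Delta>_P\<close>: after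
  exchanging the sums, the multinomial coefficients cancel, each \<open>D\<close> contributes
  \<open>pmf P D * eta n x\<close>, and \<open>P\<close> has total mass one.\<close>

lemma sum_kernel_eta:
  assumes P: "set_pmf P \<subseteq> weak_compositions n" and x: "x \<in> B n"
  shows "(\<Sum>y\<in>B n. kernel n P x y * eta n y) = eta n x"
proof -
  have "((\<lambda>D. \<Sum>y\<in>B n. pmf P D / multinomial D * coord (descent D x) y * eta n y)
      has_sum (\<Sum>y\<in>B n. kernel n P x y * eta n y)) (weak_compositions n)"
    by (intro has_sum_finite_sum has_sum_cmult_left kernel_has_sum x)
  moreover have "(\<Sum>y\<in>B n. pmf P D / multinomial D * coord (descent D x) y * eta n y) = pmf P D * eta n x"
    if "D \<in> weak_compositions n" for D
  proof -
    have "(\<Sum>y\<in>B n. pmf P D / multinomial D * coord (descent D x) y * eta n y) =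
        pmf P D / multinomial D * (\<Sum>y\<in>B n. coord (descent D x) y * eta n y)"
      by (simp add: sum_distrib_left mult.assoc)
    then show ?thesis using multinomial_pos[of D] by (simp add: sum_coord_descent_eta[OF that])
  qed
  ultimately have "((\<lambda>D. pmf P D * eta n x) has_sum (\<Sum>y\<in>B n. kernel n P x y * eta n y)) (weak_compositions n)"
    by (simp cong: has_sum_cong)
  moreover have "((\<lambda>D. pmf P D * eta n x) has_sum (1 * eta n x)) (weak_compositions n)"
    by (intro has_sum_cmult_left pmf_has_sum P)
  ultimately show ?thesis using has_sum_unique by fastforce
qed

lemma doob_matrix_eq:
  assumes "y \<in> B n"
  shows "doob_matrix H \<Delta> \<epsilon> B n P x y = kernel n P x y * (eta n y / eta n x)"
proof -
  have "coord (descent_operator H \<Delta> \<epsilon> B n P x) y = (\<Sum>z\<in>B n. kernel n P x z * coord z y)"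
    unfolding descent_operator_def kernel_def
    by (simp add: linear_sum[OF linear_coord] linear_scale[OF linear_coord])
  also have "\<dots> = (\<Sum>z\<in>B n. if z = y then kernel n P x z else 0)"
    by (intro sum.cong) (simp_all add: coord_basis)
  also have "\<dots> = kernel n P x y" using assms finite_B by simp
  finally show ?thesis by (simp add: doob_matrix_def rescaling_eq_eta)
qed

lemma transition_matrix_doob:
  assumes "set_pmf P \<subseteq> weak_compositions n"
  shows "transition_matrix (B n) (doob_matrix H \<Delta> \<epsilon> B n P)"
  unfolding transition_matrix_def
proof (intro conjI ballI)
  fix x assume x: "x \<in> B n"
  show "doob_matrix H \<Delta> \<epsilon> B n P x y \<ge> 0" if "y \<in> B n" for y
    using kernel_nonneg[OF x that] eta_nonneg[OF x] eta_nonneg[OF that] by (simp add: doob_matrix_eq[OF that])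
  have "(\<Sum>y\<in>B n. doob_matrix H \<Delta> \<epsilon> B n P x y) = (\<Sum>y\<in>B n. kernel n P x y * eta n y) / eta n x"
    by (simp add: doob_matrix_eq sum_divide_distrib)
  then show "(\<Sum>y\<in>B n. doob_matrix H \<Delta> \<epsilon> B n P x y) = 1"
    using eta_pos[OF x] by (simp add: sum_kernel_eta[OF assms x])
qed (rule finite_B)

end

section \<open>Preimage sums\<close>

text \<open>The inductive step for showing that a coalgebra morphism \<open>f\<close> commutes with
  iterated coproducts: if \<open>f\<close> intertwines \<open>G'\<close> and \<open>G\<close>, it
  intertwines the maps that apply them to the second factor.\<close>

lemma tensor_functor_tensor_map:
  fixes f :: "'b::real_vector \<Rightarrow> 'a::real_vector"
  assumes "linear f" "linear G" "linear G'" and G: "\<And>b. G (f b) = tensor_functor f (G' b)"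
  shows "tensor_map tens1 G (tensor_map (\<lambda>a. tens1 (f a)) (\<lambda>a. tens1 (f a)) t) =
    tensor_functor f (tensor_map tens1 G' t)"
proof -
  have lf: "linear (\<lambda>a. tens1 (f a))" by (rule linear_compose'[OF assms(1) linear_tens1])
  note L = linear_tensor_map[OF linear_tens1 assms(2)] linear_tensor_map[OF lf lf]
    linear_tensor_map[OF linear_tens1 assms(3)] linear_tensor_functor[OF assms(1)]
  show ?thesis
  proof (rule tensor_eqI[of _ _ t])
    show "linear (\<lambda>t. tensor_map tens1 G (tensor_map (\<lambda>a. tens1 (f a)) (\<lambda>a. tens1 (f a)) t))"
      by (rule linear_compose'[OF L(2,1)])
    show "linear (\<lambda>t. tensor_functor f (tensor_map tens1 G' t))"
      by (rule linear_compose'[OF L(3,4)])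
    fix xs
    show "tensor_map tens1 G (tensor_map (\<lambda>a. tens1 (f a)) (\<lambda>a. tens1 (f a)) (tens xs)) =
        tensor_functor f (tensor_map tens1 G' (tens xs))"
    proof (cases "length xs = 2")
      case True
      then obtain a b where "xs = [a, b]" by (auto simp: length_Suc_conv numeral_2_eq_2)
      then show ?thesis
        by (simp add: tensor_map_tens[OF lf lf] tensor_map_tens[OF linear_tens1 assms(2)]
            tensor_map_tens[OF linear_tens1 assms(3)] tensor_append_tens1 G
            tensor_functor_append_tens[OF assms(1)])
    next
      case False
      then show ?thesis
        by (simp add: tensor_map_tens_zero[OF lf lf] tensor_map_tens_zero[OF linear_tens1 assms(3)]
            linear_0[OF L(1)] linear_0[OF L(4)])
    qed
  qed
qed

lemma tensor_eval_functor:
  fixes f :: "'b::real_vector \<Rightarrow> 'a::real_vector"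
  assumes "linear f" "\<forall>\<phi>\<in>set \<phi>s. linear \<phi>"
  shows "tensor_eval \<phi>s (tensor_functor f t) = tensor_eval (map (\<lambda>\<phi> x. \<phi> (f x)) \<phi>s) t"
proof (rule tensor_eqI[of _ _ t])
  have lin: "\<forall>\<phi>\<in>set (map (\<lambda>\<phi> x. \<phi> (f x)) \<phi>s). linear \<phi>"
    using assms linear_compose' by auto
  show "linear (\<lambda>t. tensor_eval \<phi>s (tensor_functor f t))"
    by (rule linear_compose'[OF linear_tensor_functor linear_tensor_eval]) (rule assms)+
  show "linear (tensor_eval (map (\<lambda>\<phi> x. \<phi> (f x)) \<phi>s))" by (rule linear_tensor_eval[OF lin])
  fix xs
  have "map2 (\<lambda>\<phi> x. \<phi> x) \<phi>s (map f xs) = map2 (\<lambda>\<phi> x. \<phi> x) (map (\<lambda>\<phi> x. \<phi> (f x)) \<phi>s) xs"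
    by (simp add: zip_map1 zip_map2 split_def)
  then show "tensor_eval \<phi>s (tensor_functor f (tens xs)) = tensor_eval (map (\<lambda>\<phi> x. \<phi> (f x)) \<phi>s) (tens xs)"
    by (simp add: tensor_functor_tens[OF assms(1)] tensor_eval_tens[OF assms(2)] tensor_eval_tens[OF lin])
qed

text \<open>The morphism \<open>f\<close> runs against \<open>\<theta>\<close>, from the algebra of
  the lumped chain to that of the original chain.\<close>

locale preimage_sum_morphism =
  src: descent_hopf_algebra H \<Delta> \<epsilon> B + tgt: descent_hopf_algebra H' \<Delta>' \<epsilon>' B'
  for H :: "nat \<Rightarrow> 'a::real_algebra_1 set" and \<Delta> \<epsilon> and B :: "nat \<Rightarrow> 'a set"
    and H' :: "nat \<Rightarrow> 'b::real_algebra_1 set" and \<Delta>' \<epsilon>' and B' :: "nat \<Rightarrow> 'b set" +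
  fixes \<theta> :: "'a \<Rightarrow> 'b" and f :: "'b \<Rightarrow> 'a"
  assumes \<theta>_in: "b \<in> B k \<Longrightarrow> \<theta> b \<in> B' k"
    and morphism: "hopf_morphism \<Delta>' \<epsilon>' \<Delta> \<epsilon> f"
    and f_basis: "x' \<in> B' k \<Longrightarrow> f x' = (\<Sum>x | x \<in> basis_union B \<and> \<theta> x = x'. x)"
begin

lemma linear_f: "linear f"
  and f_mult: "f (x * y) = f x * f y"
  and f_one: "f 1 = 1"
  and f_coproduct: "\<Delta> (f x) = tensor_map (\<lambda>a. tens1 (f a)) (\<lambda>a. tens1 (f a)) (\<Delta>' x)"
  and f_counit: "\<epsilon> (f x) = \<epsilon>' x"
  using morphism by (auto simp: hopf_morphism_def)

text \<open>Since \<open>\<theta>\<close> preserves degrees and a basis element has only one degree,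
  a fibre over the whole basis already lies in one finite \<open>B k\<close>.\<close>

lemma preimage_eq: "x' \<in> B' k \<Longrightarrow> {x. x \<in> basis_union B \<and> \<theta> x = x'} = {x \<in> B k. \<theta> x = x'}"
  using \<theta>_in tgt.B_disjoint tgt.B_in_H by blast

lemma f_basis_graded: "x' \<in> B' k \<Longrightarrow> f x' = (\<Sum>x | x \<in> B k \<and> \<theta> x = x'. x)"
  by (simp only: f_basis preimage_eq)

lemma f_in: "z \<in> H' k \<Longrightarrow> f z \<in> H k"
proof -
  have "f ` B' k \<subseteq> H k"
    by (auto simp: f_basis_graded src.B_in_H intro!: subspace_sum src.subspace_H)
  then have "span (f ` B' k) \<subseteq> H k" using src.subspace_H by (rule span_minimal)
  then show "z \<in> H' k \<Longrightarrow> f z \<in> H k"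
    using tgt.span_B[of k] linear_span_image[OF linear_f, of "B' k"] by auto
qed

text \<open>Coordinates pull back along \<open>\<theta>\<close>: the preimage sum
  \<open>f x'\<close> contains \<open>b\<close>, once, exactly when
  \<open>x' = \<theta> b\<close>.\<close>

lemma coord_f:
  assumes b: "b \<in> B n"
  shows "src.coord (f z) b = tgt.coord z (\<theta> b)"
proof -
  have "(\<lambda>z. src.coord (f z) b) = (\<lambda>z. tgt.coord z (\<theta> b))"
  proof (rule tgt.linear_eq_on_basis[OF linear_compose'[OF linear_f src.linear_coord] tgt.linear_coord])
    fix k x' assume x': "x' \<in> B' k"
    have "src.coord (f x') b = (\<Sum>x | x \<in> B k \<and> \<theta> x = x'. src.coord x b)"
      by (simp add: f_basis_graded[OF x'] linear_sum[OF src.linear_coord])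
    also have "\<dots> = (\<Sum>x | x \<in> B k \<and> \<theta> x = x'. if x = b then 1 else 0)"
      by (intro sum.cong) (auto simp: src.coord_basis)
    also have "\<dots> = (if b \<in> B k \<and> \<theta> b = x' then 1 else 0)"
      using src.finite_B[of k] by simp
    \<comment> \<open>If \<open>\<theta> b = x'\<close>, then \<open>b\<close> and \<open>x'\<close>
      have the same degree, so \<open>b\<close> lies in \<open>B k\<close> automatically.\<close>
    also have "\<dots> = tgt.coord x' (\<theta> b)"
      using tgt.B_disjoint[OF x', of n] tgt.B_in_H[OF \<theta>_in[OF b]] b by (auto simp: tgt.coord_basis[OF x'])
    finally show "src.coord (f x') b = tgt.coord x' (\<theta> b)" .
  qed
  then show ?thesis by (rule fun_cong)
qed

lemma sum_fibre:
  assumes "linear g" "x' \<in> B' n"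
  shows "(\<Sum>x | x \<in> B n \<and> \<theta> x = x'. g x) = g (f x')"
  by (simp add: f_basis_graded[OF assms(2)] linear_sum[OF assms(1)])

lemma f_iterated_coproduct:
  "iterated_coproduct \<Delta> \<epsilon> l (f x) = tensor_functor f (iterated_coproduct \<Delta>' \<epsilon>' l x)"
proof (induction l arbitrary: x rule: induct_nat_012)
  case 0
  then show ?case
    by (simp add: f_counit linear_scale[OF linear_tensor_functor[OF linear_f]] tensor_functor_tens[OF linear_f])
next
  case 1
  then show ?case by (simp add: tensor_functor_tens[OF linear_f])
next
  case (ge2 l)
  show ?case unfolding iterated_coproduct.simps f_coproduct
    by (rule tensor_functor_tensor_map[OF linear_f src.linear_iterated_coproduct
          tgt.linear_iterated_coproduct ge2(2)])
qed

lemma f_component: "component H n (f z) = f (component H' n z)"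
proof -
  have "(\<lambda>z. component H n (f z)) = (\<lambda>z. f (component H' n z))"
    by (rule tgt.linear_eq_on_homogeneous)
      (auto intro!: linear_compose'[OF linear_f linear_component] linear_compose'[OF linear_component linear_f]
        src.graded_by tgt.graded_by simp: component_homogeneous[OF src.graded_by f_in]
        component_homogeneous[OF tgt.graded_by] linear_0[OF linear_f])
  then show ?thesis by (rule fun_cong)
qed

lemma f_prod_list: "prod_list (map f xs) = f (prod_list xs)"
  by (induction xs) (simp_all add: f_one f_mult)

lemma f_graded_projection:
  "tensor_prod (graded_projection H D (tensor_functor f t)) = f (tensor_prod (graded_projection H' D t))"
proof (rule tensor_eqI[of _ _ t])
  show "linear (\<lambda>t. tensor_prod (graded_projection H D (tensor_functor f t)))"
    by (rule linear_compose'[OF linear_compose'[OF linear_tensor_functor[OF linear_f]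
            src.linear_graded_projection] linear_tensor_prod])
  show "linear (\<lambda>t. f (tensor_prod (graded_projection H' D t)))"
    by (rule linear_compose'[OF linear_compose'[OF tgt.linear_graded_projection linear_tensor_prod] linear_f])
  fix xs
  have "map2 (component H) D (map f xs) = map f (map2 (component H') D xs)"
    by (simp add: zip_map2 split_def f_component)
  then show "tensor_prod (graded_projection H D (tensor_functor f (tens xs))) =
      f (tensor_prod (graded_projection H' D (tens xs)))"
    by (simp add: tensor_functor_tens[OF linear_f] src.graded_projection_tens tgt.graded_projection_tens
        tensor_prod_tens f_prod_list[symmetric] linear_0[OF linear_f] linear_0[OF linear_tensor_prod])
qed

lemma f_descent: "src.descent D (f x) = f (tgt.descent D x)"
  by (simp add: coproduct_comp_def f_iterated_coproduct f_graded_projection)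

text \<open>\<open>\<theta>\<close> sends \<open>bullet\<close> to \<open>bullet\<close>, because
  \<open>B' 1\<close> is a singleton, so the bullet coordinates correspond under \<open>f\<close>.
  Their convolution powers correspond since \<open>f\<close> commutes with iterated
  coproducts.\<close>

lemma f_eta: "src.eta n (f x) = tgt.eta n x"
proof -
  have "\<theta> src.bullet = tgt.bullet"
    using \<theta>_in[OF src.bullet_in] tgt.B_1 by auto
  then have "(\<lambda>x. src.bullet_coord (f x)) = tgt.bullet_coord"
    using coord_f[OF src.bullet_in] by (auto simp: src.bullet_coord_def tgt.bullet_coord_def)
  moreover have "\<forall>\<phi>\<in>set (replicate n src.bullet_coord). linear \<phi>" by (simp add: src.linear_bullet_coord)
  moreover have "\<forall>\<phi>\<in>set (replicate n tgt.bullet_coord). linear \<phi>" by (simp add: tgt.linear_bullet_coord)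
  ultimately show ?thesis
    using src.tensor_eval_iterated_coproduct[of "replicate n src.bullet_coord" "f x"]
      tgt.tensor_eval_iterated_coproduct[of "replicate n tgt.bullet_coord" x]
    by (simp add: src.conv_power_def tgt.conv_power_def f_iterated_coproduct
        tensor_eval_functor[OF linear_f])
qed

lemma \<theta>_surj: "\<theta> ` B n = B' n"
proof
  show "\<theta> ` B n \<subseteq> B' n" using \<theta>_in by blast
  show "B' n \<subseteq> \<theta> ` B n"
  proof
    fix x' assume x': "x' \<in> B' n"
    show "x' \<in> \<theta> ` B n"
    proof (rule ccontr)
      assume "x' \<notin> \<theta> ` B n"
      then have "{x. x \<in> B n \<and> \<theta> x = x'} = {}" by auto
      then have "f x' = 0" by (simp only: f_basis_graded[OF x'] sum.empty)
      then have "tgt.eta n x' = 0" using f_eta[of n x'] linear_0[OF src.linear_eta] by simp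
      then show False using tgt.eta_pos[OF x'] by simp
    qed
  qed
qed

section \<open>Sums over the fibres of the lumping map\<close>

lemma sum_fibre_eta: "x' \<in> B' n \<Longrightarrow> (\<Sum>x | x \<in> B n \<and> \<theta> x = x'. src.eta n x) = tgt.eta n x'"
  by (simp add: sum_fibre[OF src.linear_eta] f_eta)

text \<open>For each \<open>D\<close> the fibre sum is the coefficient of \<open>y\<close> in
  \<open>descent D (f x') = f (descent D x')\<close>, which is a coefficient of
  \<open>\<theta> y\<close> in the target. Summation over \<open>D\<close> preserves the
  identity.\<close>

lemma sum_fibre_kernel:
  assumes x': "x' \<in> B' n" and y: "y \<in> B n"
  shows "(\<Sum>x | x \<in> B n \<and> \<theta> x = x'. src.kernel n P x y) = tgt.kernel n P x' (\<theta> y)"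
proof -
  have "((\<lambda>D. \<Sum>x | x \<in> B n \<and> \<theta> x = x'. pmf P D / multinomial D * src.coord (src.descent D x) y)
      has_sum (\<Sum>x | x \<in> B n \<and> \<theta> x = x'. src.kernel n P x y)) (weak_compositions n)"
    by (intro has_sum_finite_sum src.kernel_has_sum y) auto
  moreover have "(\<Sum>x | x \<in> B n \<and> \<theta> x = x'. pmf P D / multinomial D * src.coord (src.descent D x) y) =
      pmf P D / multinomial D * tgt.coord (tgt.descent D x') (\<theta> y)" for D
    by (simp only: sum_distrib_left[symmetric] f_descent coord_f[OF y]
        sum_fibre[OF linear_compose'[OF src.linear_descent src.linear_coord] x'])
  ultimately have "((\<lambda>D. pmf P D / multinomial D * tgt.coord (tgt.descent D x') (\<theta> y))
      has_sum (\<Sum>x | x \<in> B n \<and> \<theta> x = x'. src.kernel n P x y)) (weak_compositions n)"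
    by simp
  then show ?thesis
    using tgt.kernel_has_sum[OF x' \<theta>_in[OF y]] by (rule has_sum_unique)
qed

end

section \<open>Weak lumping\<close>

text \<open>Used both with \<open>Y\<close> the present state and with \<open>Y\<close> the whole
  path up to a given time.\<close>

lemma (in finite_measure) measure_partition:
  assumes "finite F" "\<And>\<omega>. \<omega> \<in> space M \<Longrightarrow> Q \<omega> \<Longrightarrow> Y \<omega> \<in> F"
    and "\<And>x. x \<in> F \<Longrightarrow> {\<omega> \<in> space M. Y \<omega> = x \<and> Q \<omega>} \<in> sets M"
  shows "measure M {\<omega> \<in> space M. Q \<omega>} = (\<Sum>x\<in>F. measure M {\<omega> \<in> space M. Y \<omega> = x \<and> Q \<omega>})"
proof -
  have "{\<omega> \<in> space M. Q \<omega>} = (\<Union>x\<in>F. {\<omega> \<in> space M. Y \<omega> = x \<and> Q \<omega>})"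
    using assms(2) by auto
  also have "measure M \<dots> = (\<Sum>x\<in>F. measure M {\<omega> \<in> space M. Y \<omega> = x \<and> Q \<omega>})"
    by (rule finite_measure_finite_Union) (use assms(1,3) in \<open>auto simp: disjoint_family_on_def\<close>)
  finally show ?thesis .
qed

lemma markov_chain_event:
  assumes "markov_chain M X \<Omega> K"
  shows "{\<omega> \<in> space M. Q (X i \<omega>)} \<in> sets M"
proof -
  have X: "X i \<in> M \<rightarrow>\<^sub>M count_space \<Omega>" using assms by (simp add: markov_chain_def)
  have "{\<omega> \<in> space M. Q (X i \<omega>)} = X i -` {a \<in> \<Omega>. Q a} \<inter> space M"
    using measurable_space[OF X] by auto
  then show ?thesis using measurable_sets[OF X, of "{a \<in> \<Omega>. Q a}"] by simp
qed

lemma markov_chain_event_all: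
  assumes "markov_chain M X \<Omega> K"
  shows "{\<omega> \<in> space M. \<forall>i\<le>t. Q i (X i \<omega>)} \<in> sets M"
proof -
  have "(\<Inter>i\<in>{..t}. {\<omega> \<in> space M. Q i (X i \<omega>)}) \<in> sets M"
    using markov_chain_event[OF assms] by (intro sets.finite_INT) simp_all
  also have "(\<Inter>i\<in>{..t}. {\<omega> \<in> space M. Q i (X i \<omega>)}) = {\<omega> \<in> space M. \<forall>i\<le>t. Q i (X i \<omega>)}"
    by auto
  finally show ?thesis .
qed

text \<open>The Markov property in product form, which also covers paths of probability zero, where
  the conditional form says nothing.\<close>

lemma markov_chain_path_step:
  assumes mc: "markov_chain M X \<Omega> K" and p: "\<And>i. i \<le> t \<Longrightarrow> p i \<in> \<Omega>" and y: "y \<in> \<Omega>"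
  shows "measure M {\<omega> \<in> space M. (\<forall>i\<le>t. X i \<omega> = p i) \<and> X (Suc t) \<omega> = y} =
    measure M {\<omega> \<in> space M. \<forall>i\<le>t. X i \<omega> = p i} * K (p t) y"
proof -
  interpret prob_space M using mc by (simp add: markov_chain_def)
  have path: "{\<omega> \<in> space M. \<forall>i\<le>t. X i \<omega> = p i} \<in> sets M"
    by (rule markov_chain_event_all[OF mc, where Q = "\<lambda>i a. a = p i"])
  show ?thesis
  proof (cases "prob {\<omega> \<in> space M. \<forall>i\<le>t. X i \<omega> = p i} = 0")
    case True
    moreover have "prob {\<omega> \<in> space M. (\<forall>i\<le>t. X i \<omega> = p i) \<and> X (Suc t) \<omega> = y}
        \<le> prob {\<omega> \<in> space M. \<forall>i\<le>t. X i \<omega> = p i}"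
      by (rule finite_measure_mono[OF _ path]) auto
    ultimately show ?thesis by (simp add: measure_le_0_iff)
  next
    case False
    \<comment> \<open>The Markov property speaks of one sequence of states, so the path
      \<open>p\<close> is continued by \<open>y\<close> at time \<open>Suc t\<close>.\<close>
    define x where "x = p(Suc t := y)"
    have x: "x (Suc t) = y" "x t = p t" by (simp_all add: x_def)
    have eq: "(\<forall>i\<le>t. X i \<omega> = x i) \<longleftrightarrow> (\<forall>i\<le>t. X i \<omega> = p i)" for \<omega> by (auto simp: x_def)
    have "\<forall>i\<le>Suc t. x i \<in> \<Omega>" using p y by (auto simp: x_def le_Suc_eq)
    then have "\<P>(\<omega> in M. X (Suc t) \<omega> = y \<bar> \<forall>i\<le>t. X i \<omega> = p i) = K (p t) y"
      using mc False unfolding markov_chain_def eq[symmetric] x[symmetric] by blast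
    then show ?thesis using False by (simp add: cond_prob_def field_simps conj_commute)
  qed
qed

section \<open>A criterion for weak lumping\<close>

text \<open>Being distributed proportionally to \<open>w\<close> on each fibre, given the lumped
  past, is preserved in time by \<open>fibre\<close>. For the Doob transform, \<open>w\<close> and
  \<open>w'\<close> are the two rescaling functions and \<open>R\<close> is the target kernel before
  rescaling.\<close>

lemma weak_lumping:
  assumes mc: "markov_chain M X \<Omega> K" and K': "transition_matrix \<Omega>' K'" and \<theta>: "\<theta> ` \<Omega> = \<Omega>'"
    and w: "\<And>x. x \<in> \<Omega> \<Longrightarrow> w x > 0"
    and w': "\<And>x'. x' \<in> \<Omega>' \<Longrightarrow> (\<Sum>x | x \<in> \<Omega> \<and> \<theta> x = x'. w x) = w' x'"
    and fibre: "\<And>x' y. x' \<in> \<Omega>' \<Longrightarrow> y \<in> \<Omega> \<Longrightarrow>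
      (\<Sum>x | x \<in> \<Omega> \<and> \<theta> x = x'. w x * K x y) = w y * R x' (\<theta> y)"
    and K'_eq: "\<And>x' y'. x' \<in> \<Omega>' \<Longrightarrow> y' \<in> \<Omega>' \<Longrightarrow> K' x' y' = R x' y' * (w' y' / w' x')"
    and init: "\<And>x y. x \<in> \<Omega> \<Longrightarrow> y \<in> \<Omega> \<Longrightarrow> \<theta> x = \<theta> y \<Longrightarrow>
      \<P>(\<omega> in M. X 0 \<omega> = x) / w x = \<P>(\<omega> in M. X 0 \<omega> = y) / w y"
  shows "markov_chain M (\<lambda>t \<omega>. \<theta> (X t \<omega>)) \<Omega>' K'"
proof -
  interpret prob_space M using mc by (simp add: markov_chain_def)
  have fin: "finite \<Omega>" using mc by (simp add: markov_chain_def transition_matrix_def)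
  have X: "X i \<in> M \<rightarrow>\<^sub>M count_space \<Omega>" for i using mc by (simp add: markov_chain_def)
  have in_\<Omega>: "X i \<omega> \<in> \<Omega>" if "\<omega> \<in> space M" for i \<omega> using measurable_space[OF X that] by simp
  have ev: "{\<omega> \<in> space M. X i \<omega> = x} \<in> sets M" for i x
    by (rule markov_chain_event[OF mc, where Q = "\<lambda>a. a = x"])
  have ev_\<theta>: "{\<omega> \<in> space M. \<forall>i\<le>t. \<theta> (X i \<omega>) = x' i} \<in> sets M" for t x'
    by (rule markov_chain_event_all[OF mc, where Q = "\<lambda>i a. \<theta> a = x' i"])
  have ev_path: "{\<omega> \<in> space M. \<forall>i\<le>t. X i \<omega> = p i} \<in> sets M" for t p
    by (rule markov_chain_event_all[OF mc, where Q = "\<lambda>i a. a = p i"])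
  \<comment> \<open>The law of the present state on the event of a given lumped past. It is left
    unnormalised, so that pasts of probability zero need no separate treatment.\<close>
  define N where "N x' t y = prob {\<omega> \<in> space M. (\<forall>i\<le>t. \<theta> (X i \<omega>) = x' i) \<and> X t \<omega> = y}" for x' t y
  have N_sum: "prob {\<omega> \<in> space M. \<forall>i\<le>t. \<theta> (X i \<omega>) = x' i} = (\<Sum>x | x \<in> \<Omega> \<and> \<theta> x = x' t. N x' t x)" for x' t
  proof -
    have "prob {\<omega> \<in> space M. \<forall>i\<le>t. \<theta> (X i \<omega>) = x' i} = (\<Sum>x\<in>{x \<in> \<Omega>. \<theta> x = x' t}.
        prob {\<omega> \<in> space M. X t \<omega> = x \<and> (\<forall>i\<le>t. \<theta> (X i \<omega>) = x' i)})"
    proof (rule measure_partition)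
      show "{\<omega> \<in> space M. X t \<omega> = x \<and> (\<forall>i\<le>t. \<theta> (X i \<omega>) = x' i)} \<in> sets M" for x
        by (rule sets.sets_Collect_conj[OF ev_\<theta> ev])
    qed (use fin in_\<Omega> in auto)
    then show ?thesis by (simp only: N_def conj_commute)
  qed
  have N_step: "N x' (Suc t) y = (\<Sum>x | x \<in> \<Omega> \<and> \<theta> x = x' t. N x' t x * K x y)"
    if y: "y \<in> \<Omega>" "\<theta> y = x' (Suc t)" for x' t y
  proof -
    \<comment> \<open>The finitely many lifts of the lumped past; extensional functions give exactly
      one representative for each path up to time \<open>t\<close>.\<close>
    define S where "S = {p \<in> {..t} \<rightarrow>\<^sub>E \<Omega>. \<forall>i\<le>t. \<theta> (p i) = x' i}"
    have S: "finite S" unfolding S_def using fin by (simp add: finite_PiE)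
    have path_eq: "restrict (\<lambda>i. X i \<omega>) {..t} = p \<longleftrightarrow> (\<forall>i\<le>t. X i \<omega> = p i)" if "p \<in> S" for p \<omega>
      using that unfolding S_def by (auto simp: fun_eq_iff PiE_def extensional_def)
    have restr: "restrict (\<lambda>i. X i \<omega>) {..t} \<in> S \<longleftrightarrow> (\<forall>i\<le>t. \<theta> (X i \<omega>) = x' i)" if "\<omega> \<in> space M" for \<omega>
      using in_\<Omega>[OF that] by (auto simp: S_def)
    have part: "prob {\<omega> \<in> space M. (\<forall>i\<le>t. \<theta> (X i \<omega>) = x' i) \<and> Q \<omega>} =
        (\<Sum>p\<in>S. prob {\<omega> \<in> space M. (\<forall>i\<le>t. X i \<omega> = p i) \<and> Q \<omega>})"
      if Q: "{\<omega> \<in> space M. Q \<omega>} \<in> sets M" for Q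
    proof -
      have *: "{\<omega> \<in> space M. restrict (\<lambda>i. X i \<omega>) {..t} = p \<and> (\<forall>i\<le>t. \<theta> (X i \<omega>) = x' i) \<and> Q \<omega>} =
          {\<omega> \<in> space M. (\<forall>i\<le>t. X i \<omega> = p i) \<and> Q \<omega>}" if "p \<in> S" for p
        using that path_eq[OF that] by (auto simp: S_def)
      have "prob {\<omega> \<in> space M. (\<forall>i\<le>t. \<theta> (X i \<omega>) = x' i) \<and> Q \<omega>} = (\<Sum>p\<in>S. prob {\<omega> \<in> space M.
          restrict (\<lambda>i. X i \<omega>) {..t} = p \<and> (\<forall>i\<le>t. \<theta> (X i \<omega>) = x' i) \<and> Q \<omega>})"
      proof (rule measure_partition[OF S])
        show "restrict (\<lambda>i. X i \<omega>) {..t} \<in> S"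
          if "\<omega> \<in> space M" "(\<forall>i\<le>t. \<theta> (X i \<omega>) = x' i) \<and> Q \<omega>" for \<omega>
          using restr that by blast
        show "{\<omega> \<in> space M. restrict (\<lambda>i. X i \<omega>) {..t} = p \<and> (\<forall>i\<le>t. \<theta> (X i \<omega>) = x' i) \<and> Q \<omega>} \<in> sets M"
          if "p \<in> S" for p
          unfolding *[OF that] by (rule sets.sets_Collect_conj[OF Q ev_path])
      qed
      then show ?thesis by (simp add: *)
    qed
    have x't: "S = (\<Union>x\<in>{x \<in> \<Omega>. \<theta> x = x' t}. {p \<in> S. p t = x})" by (auto simp: S_def)
    have N_t: "N x' t x = (\<Sum>p\<in>{p \<in> S. p t = x}. prob {\<omega> \<in> space M. \<forall>i\<le>t. X i \<omega> = p i})" for x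
    proof -
      have "N x' t x = (\<Sum>p\<in>S. prob {\<omega> \<in> space M. (\<forall>i\<le>t. X i \<omega> = p i) \<and> X t \<omega> = x})"
        unfolding N_def by (rule part[OF ev])
      also have "\<dots> = (\<Sum>p\<in>S. if p t = x then prob {\<omega> \<in> space M. \<forall>i\<le>t. X i \<omega> = p i} else 0)"
      proof (intro sum.cong refl)
        fix p
        have "{\<omega> \<in> space M. (\<forall>i\<le>t. X i \<omega> = p i) \<and> X t \<omega> = x} =
            (if p t = x then {\<omega> \<in> space M. \<forall>i\<le>t. X i \<omega> = p i} else {})" by auto
        then show "prob {\<omega> \<in> space M. (\<forall>i\<le>t. X i \<omega> = p i) \<and> X t \<omega> = x} =
            (if p t = x then prob {\<omega> \<in> space M. \<forall>i\<le>t. X i \<omega> = p i} else 0)" by simp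
      qed
      finally show ?thesis using S by (simp add: sum.inter_filter)
    qed
    have "N x' (Suc t) y = prob {\<omega> \<in> space M. (\<forall>i\<le>t. \<theta> (X i \<omega>) = x' i) \<and> X (Suc t) \<omega> = y}"
      unfolding N_def using y(2) by (intro arg_cong[of _ _ prob]) (auto simp: le_Suc_eq)
    also have "\<dots> = (\<Sum>p\<in>S. prob {\<omega> \<in> space M. (\<forall>i\<le>t. X i \<omega> = p i) \<and> X (Suc t) \<omega> = y})"
      by (rule part[OF ev])
    also have "\<dots> = (\<Sum>p\<in>S. prob {\<omega> \<in> space M. \<forall>i\<le>t. X i \<omega> = p i} * K (p t) y)"
      by (intro sum.cong refl markov_chain_path_step[OF mc _ y(1)]) (auto simp: S_def)
    also have "\<dots> = (\<Sum>x | x \<in> \<Omega> \<and> \<theta> x = x' t. \<Sum>p\<in>{p \<in> S. p t = x}.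
        prob {\<omega> \<in> space M. \<forall>i\<le>t. X i \<omega> = p i} * K (p t) y)"
      by (subst x't, rule sum.UNION_disjoint) (use S fin in auto)
    also have "\<dots> = (\<Sum>x | x \<in> \<Omega> \<and> \<theta> x = x' t. N x' t x * K x y)"
      by (intro sum.cong refl) (simp add: N_t sum_distrib_right)
    finally show ?thesis .
  qed
  have N_prop: "\<exists>c. \<forall>y\<in>\<Omega>. \<theta> y = x' t \<longrightarrow> N x' t y = c * w y" if "\<And>i. i \<le> t \<Longrightarrow> x' i \<in> \<Omega>'" for x' t
    using that
  proof (induction t)
    case 0
    then have "x' 0 \<in> \<theta> ` \<Omega>" unfolding \<theta> by simp
    then obtain y0 where y0: "y0 \<in> \<Omega>" "\<theta> y0 = x' 0" by (metis imageE)
    \<comment> \<open>The constant is read off at one point \<open>y0\<close> of the fibre, and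
      \<open>init\<close> makes it the same at every other point.\<close>
    have "N x' 0 y = (N x' 0 y0 / w y0) * w y" if "y \<in> \<Omega>" "\<theta> y = x' 0" for y
    proof -
      have "N x' 0 z = \<P>(\<omega> in M. X 0 \<omega> = z)" if "\<theta> z = x' 0" for z
        unfolding N_def using that by (intro arg_cong[of _ _ prob]) auto
      then show ?thesis using init[of y y0] y0 that w[of y] by (simp add: field_simps)
    qed
    then show ?case by blast
  next
    case (Suc t)
    have "\<exists>c. \<forall>y\<in>\<Omega>. \<theta> y = x' t \<longrightarrow> N x' t y = c * w y"
      by (rule Suc.IH) (simp add: Suc.prems)
    then obtain c where c: "\<And>y. y \<in> \<Omega> \<Longrightarrow> \<theta> y = x' t \<Longrightarrow> N x' t y = c * w y" by blast
    \<comment> \<open>One step multiplies the constant by \<open>R (x' t) (x' (Suc t))\<close>, the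
      same for the whole new fibre because \<open>fibre\<close> involves \<open>y\<close> only
      through \<open>w y\<close> and \<open>\<theta> y\<close>.\<close>
    have "N x' (Suc t) y = (c * R (x' t) (x' (Suc t))) * w y" if y: "y \<in> \<Omega>" "\<theta> y = x' (Suc t)" for y
    proof -
      have "N x' (Suc t) y = c * (\<Sum>x | x \<in> \<Omega> \<and> \<theta> x = x' t. w x * K x y)"
        unfolding N_step[of y x' t, OF y] sum_distrib_left by (intro sum.cong) (auto simp: c)
      then show ?thesis using fibre[of "x' t" y] Suc.prems[of t] y by simp
    qed
    then show ?case by blast
  qed
  have "\<P>(\<omega> in M. \<theta> (X (Suc t) \<omega>) = x' (Suc t) \<bar> \<forall>i\<le>t. \<theta> (X i \<omega>) = x' i) = K' (x' t) (x' (Suc t))"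
    if x': "\<forall>i\<le>Suc t. x' i \<in> \<Omega>'" and nz: "\<P>(\<omega> in M. \<forall>i\<le>t. \<theta> (X i \<omega>) = x' i) \<noteq> 0" for x' t
  proof -
    have "\<exists>c. \<forall>y\<in>\<Omega>. \<theta> y = x' t \<longrightarrow> N x' t y = c * w y"
      by (rule N_prop) (use x' in simp)
    then obtain c where c: "\<And>y. y \<in> \<Omega> \<Longrightarrow> \<theta> y = x' t \<Longrightarrow> N x' t y = c * w y" by blast
    have x't: "x' t \<in> \<Omega>'" "x' (Suc t) \<in> \<Omega>'" using x' by auto
    have prob_t: "\<P>(\<omega> in M. \<forall>i\<le>t. \<theta> (X i \<omega>) = x' i) = c * w' (x' t)"
      unfolding N_sum w'[OF x't(1), symmetric] sum_distrib_left by (intro sum.cong) (auto simp: c)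
    have "N x' (Suc t) y = c * R (x' t) (x' (Suc t)) * w y" if y: "y \<in> \<Omega>" "\<theta> y = x' (Suc t)" for y
    proof -
      have "N x' (Suc t) y = c * (\<Sum>x | x \<in> \<Omega> \<and> \<theta> x = x' t. w x * K x y)"
        unfolding N_step[of y x' t, OF y] sum_distrib_left by (intro sum.cong) (auto simp: c)
      then show ?thesis using fibre[of "x' t" y] x't y by simp
    qed
    then have prob_Suc: "\<P>(\<omega> in M. \<forall>i\<le>Suc t. \<theta> (X i \<omega>) = x' i) = c * R (x' t) (x' (Suc t)) * w' (x' (Suc t))"
      unfolding N_sum w'[OF x't(2), symmetric] sum_distrib_left by (intro sum.cong) auto
    have "{\<omega> \<in> space M. \<theta> (X (Suc t) \<omega>) = x' (Suc t) \<and> (\<forall>i\<le>t. \<theta> (X i \<omega>) = x' i)} =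
        {\<omega> \<in> space M. \<forall>i\<le>Suc t. \<theta> (X i \<omega>) = x' i}" by (auto simp: le_Suc_eq)
    \<comment> \<open>In the quotient of the two path probabilities the constant \<open>c\<close>
      cancels; it is nonzero because the lumped past has positive probability.\<close>
    then show ?thesis
      using nz unfolding cond_prob_def prob_t by (simp only: prob_Suc) (simp add: K'_eq[OF x't])
  qed
  moreover have "(\<lambda>\<omega>. \<theta> (X t \<omega>)) \<in> M \<rightarrow>\<^sub>M count_space \<Omega>'" for t
    by (rule measurable_compose[OF X]) (use \<theta> in auto)
  ultimately show ?thesis
    unfolding markov_chain_def using prob_space_axioms K' by blast
qed

section \<open>The lumping criterion applied to the Doob transform chains\<close>

theorem theorem3p8:
  fixes H :: "nat \<Rightarrow> 'a::real_algebra_1 set" and \<Delta> :: "'a \<Rightarrow> 'a tensor" and \<epsilon> :: "'a \<Rightarrow> real"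
    and B :: "nat \<Rightarrow> 'a set"
    and H' :: "nat \<Rightarrow> 'b::real_algebra_1 set" and \<Delta>' :: "'b \<Rightarrow> 'b tensor" and \<epsilon>' :: "'b \<Rightarrow> real"
    and B' :: "nat \<Rightarrow> 'b set"
    and \<theta> :: "'a \<Rightarrow> 'b" and n :: nat and P :: "nat list pmf" and X0 :: "'a pmf"
  assumes "graded_connected_hopf_algebra H \<Delta> \<epsilon>" and "graded_basis H B"
    and "descent_chain_conditions \<Delta> B"
    and "graded_connected_hopf_algebra H' \<Delta>' \<epsilon>'" and "graded_basis H' B'"
    and "descent_chain_conditions \<Delta>' B'"
    and "\<forall>k. \<theta> ` B k \<subseteq> B' k"
    and "\<exists>f. hopf_morphism \<Delta>' \<epsilon>' \<Delta> \<epsilon> f \<and>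
           (\<forall>k. \<forall>x'\<in>B' k. f x' = (\<Sum>x | x \<in> basis_union B \<and> \<theta> x = x'. x))"
    and "n \<ge> 1"
    and "set_pmf P \<subseteq> weak_compositions n"
    and "set_pmf X0 \<subseteq> B n"
    and "\<forall>x\<in>B n. \<forall>y\<in>B n. \<theta> x = \<theta> y \<longrightarrow>
           pmf X0 x / rescaling H \<Delta> \<epsilon> B n x = pmf X0 y / rescaling H \<Delta> \<epsilon> B n y"
  shows "lumps_weakly TYPE('w) (B n) (doob_matrix H \<Delta> \<epsilon> B n P) X0 \<theta>
           (B' n) (doob_matrix H' \<Delta>' \<epsilon>' B' n P)"
proof -
  obtain f where f: "hopf_morphism \<Delta>' \<epsilon>' \<Delta> \<epsilon> f"
    "\<forall>k. \<forall>x'\<in>B' k. f x' = (\<Sum>x | x \<in> basis_union B \<and> \<theta> x = x'. x)"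
    using assms(8) by blast
  have src: "descent_hopf_algebra H \<Delta> \<epsilon> B"
    using assms(1-3) graded_connected_hopf_algebra.graded[OF assms(1)]
    by (simp add: descent_hopf_algebra_def descent_hopf_algebra_axioms_def graded_vector_basis_def)
  have tgt: "descent_hopf_algebra H' \<Delta>' \<epsilon>' B'"
    using assms(4-6) graded_connected_hopf_algebra.graded[OF assms(4)]
    by (simp add: descent_hopf_algebra_def descent_hopf_algebra_axioms_def graded_vector_basis_def)
  interpret preimage_sum_morphism H \<Delta> \<epsilon> B H' \<Delta>' \<epsilon>' B' \<theta> f
    by (intro preimage_sum_morphism.intro src tgt preimage_sum_morphism_axioms.intro)
      (use assms(7) f in auto)
  note P = assms(10)
  show ?thesis
    unfolding lumps_weakly_def
  proof (intro conjI allI impI src.transition_matrix_doob[OF P] tgt.transition_matrix_doob[OF P] \<theta>_surj)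
    fix M :: "'w measure" and X
    assume mc: "markov_chain M X (B n) (doob_matrix H \<Delta> \<epsilon> B n P)"
      and X0: "\<forall>x\<in>B n. \<P>(\<omega> in M. X 0 \<omega> = x) = pmf X0 x"
    show "markov_chain M (\<lambda>t \<omega>. \<theta> (X t \<omega>)) (B' n) (doob_matrix H' \<Delta>' \<epsilon>' B' n P)"
    proof (rule weak_lumping[OF mc tgt.transition_matrix_doob[OF P] \<theta>_surj])
      show "src.eta n x > 0" if "x \<in> B n" for x
        by (rule src.eta_pos[OF that])
      show "(\<Sum>x | x \<in> B n \<and> \<theta> x = x'. src.eta n x) = tgt.eta n x'" if "x' \<in> B' n" for x'
        by (rule sum_fibre_eta[OF that])
      show "(\<Sum>x | x \<in> B n \<and> \<theta> x = x'. src.eta n x * doob_matrix H \<Delta> \<epsilon> B n P x y) =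
          src.eta n y * tgt.kernel n P x' (\<theta> y)" if x': "x' \<in> B' n" and y: "y \<in> B n" for x' y
      proof -
        \<comment> \<open>The weight \<open>src.eta n x\<close> cancels the denominator of the Doob
          transform, so that the factor left over no longer depends on \<open>x\<close> and the
          fibre sum of the kernel applies.\<close>
        have "(\<Sum>x | x \<in> B n \<and> \<theta> x = x'. src.eta n x * doob_matrix H \<Delta> \<epsilon> B n P x y) =
            (\<Sum>x | x \<in> B n \<and> \<theta> x = x'. src.eta n y * src.kernel n P x y)"
        proof (intro sum.cong refl)
          fix x assume "x \<in> {x \<in> B n. \<theta> x = x'}"
          then have "src.eta n x > 0" by (simp add: src.eta_pos)
          then show "src.eta n x * doob_matrix H \<Delta> \<epsilon> B n P x y = src.eta n y * src.kernel n P x y"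
            by (simp add: src.doob_matrix_eq[OF y])
        qed
        also have "\<dots> = src.eta n y * tgt.kernel n P x' (\<theta> y)"
          by (simp only: sum_distrib_left[symmetric] sum_fibre_kernel[OF x' y])
        finally show ?thesis .
      qed
      show "doob_matrix H' \<Delta>' \<epsilon>' B' n P x' y' = tgt.kernel n P x' y' * (tgt.eta n y' / tgt.eta n x')"
        if "y' \<in> B' n" for x' y'
        by (rule tgt.doob_matrix_eq[OF that])
      show "\<P>(\<omega> in M. X 0 \<omega> = x) / src.eta n x = \<P>(\<omega> in M. X 0 \<omega> = y) / src.eta n y"
        if "x \<in> B n" "y \<in> B n" "\<theta> x = \<theta> y" for x y
        using assms(12)[unfolded src.rescaling_eq_eta, rule_format, OF that] X0 that by simp
    qed
  qed
qed

end
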